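(* Let $f:\mathbb{R}^n\to\mathbb{R}$, $F:\mathbb{R}^n\to\mathbb{R}^m$, $\mathcal{M}=\{x:F(x)=0\}$ and $x_\star$ satisfy the local standing assumptions (smoothness, manifold structure and constraint qualification, eigenvalues of the Riemannian Hessian) listed in the context. Then there exist $\varepsilon>0$ and a constant $\sigma>0$ such that the following holds. Let $x_0\in B(x_\star,\varepsilon)$ and let $(x_k)_{k\ge 0}$ be the SQP iterates started at $x_0$ with stepsize $\eta=1/\lambda_{\max}$. Put $$a_k=\|\mathsf{P}_{x_\star}(x_k-x_\star)\|_2,\qquad b_k=\|\mathsf{P}_{x_\star}^{\perp}(x_k-x_\star)\|_2 .$$ Then for all $k\ge 0$ $$a_{k+1}^2+\sigma b_{k+1}\le\Big(1-\frac{1}{2\kappa_R}\Big)^2\,(a_k^2+\sigma b_k),$$ where $\kappa_R=\lambda_{\max}/\lambda_{\min}$ is the condition number of the Riemannian Hessian of $f$ on $\mathcal{M}$ at $x_\star$. Consequently $\|x_k-x_\star\|_2^2=a_k^2+b_k^2$ also converges linearly: $\|x_k-x_\star\|_2^2\le O\big((1-1/(2\kappa_R))^k\big)$, i.e. there is a constant $C$ independent of $k$ with $\|x_k-x_\star\|_2^2\le C(1-1/(2\kappa_R))^k$ for all $k\ge0$.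
   Context: Setting. $m\le n$; $f:\mathbb{R}^n\to\mathbb{R}$ and $F:\mathbb{R}^n\to\mathbb{R}^m$ are $C^2$; $\mathcal{M}=\{x\in\mathbb{R}^n:F(x)=0\}$; $x_\star$ is a local minimizer of $f$ on $\mathcal{M}$. $\nabla f(x)\in\mathbb{R}^n$ is the gradient, $\nabla F(x)\in\mathbb{R}^{m\times n}$ the Jacobian, $A^\dagger$ the Moore–Penrose inverse (for $A\in\mathbb{R}^{m\times n}$ of rank $m$, $A^\dagger=A^{\mathsf T}(AA^{\mathsf T})^{-1}$), $A^{\dagger\mathsf T}$ its transpose, $B(x,r)$ the Euclidean ball. Matrices and tensors carry operator norms. Local standing assumptions, for some $\delta>0$: (1) Smoothness: on $B(x_\star,\delta)$, $f$ and $F$ are $C^2$ and Lipschitz with constants $L_f,L_F$, have Lipschitz gradients (Jacobians) with constants $\beta_f,\beta_F$, and Lipschitz Hessians with constants $\rho_f,\rho_F$. (2) Manifold structure and constraint qualification: $\mathcal{M}$ is an $(n-m)$-dimensional smooth submanifold of $\mathbb{R}^n$, and $\inf_{x\in B(x_\star,\delta)}\sigma_{\min}(\nabla F(x))\ge\gamma_F$ for some constant $\gamma_F>0$, where $\sigma_{\min}$ is the least singular value. (3) Eigenvalues of the Riemannian Hessian: with $\mathrm{Hess} f(x_\star)$ as defined below, let $\lambda_{\max}=\sup\{\langle u,\mathrm{Hess} f(x_\star)u\rangle:\|u\|_2=1,\nabla F(x_\star)u=0\}$ and $\lambda_{\min}=\inf\{\langle u,\mathrm{Hess} f(x_\star)u\rangle:\|u\|_2=1,\nabla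 F(x_\star)u=0\}$; then $0<\lambda_{\min}\le\lambda_{\max}<\infty$. Here $\lambda_{\max}(\mathrm{Hess} f(x_\star))$ and $\lambda_{\min}(\mathrm{Hess} f(x_\star))$ mean these numbers $\lambda_{\max},\lambda_{\min}$. Definitions. $\mathsf{P}_x=I_n-\nabla F(x)^\dagger\nabla F(x)$ and $\mathsf{P}_x^\perp=\nabla F(x)^\dagger\nabla F(x)$. The Riemannian Hessian (in matrix form) at $x_\star$ is $$\mathrm{Hess} f(x_\star)=\mathsf{P}_{x_\star}\nabla^2 f(x_\star)\mathsf{P}_{x_\star}-\sum_{i=1}^m[\nabla F(x_\star)^{\dagger\mathsf T}\nabla f(x_\star)]_i\,\mathsf{P}_{x_\star}\nabla^2F_i(x_\star)\mathsf{P}_{x_\star}.$$ SQP iterates with stepsize $\eta>0$: $x_{k+1}$ is the minimizer of $f(x_k)+\langle\nabla f(x_k),x-x_k\rangle+\frac1{2\eta}\|x-x_k\|_2^2$ over $x$ subject to $F(x_k)+\nabla F(x_k)(x-x_k)=0$. When $\nabla F(x_k)$ has rank $m$ this is $x_{k+1}=x_k-\eta\,\mathsf{P}_{x_k}\nabla f(x_k)-\nabla F(x_k)^\dagger F(x_k)$. *)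

theory Defs
  imports "HOL-Analysis.Analysis"
begin

text \<open>
  The derivative as a bounded linear map, so that the norm on derivatives of every order is the
  operator norm; the norm of the matrix type \<open>real^'n^'m\<close> is the Frobenius norm.
\<close>

definition fderiv :: "('a::real_normed_vector \<Rightarrow> 'b::real_normed_vector) \<Rightarrow> 'a \<Rightarrow> 'a \<Rightarrow>\<^sub>L 'b"
  where "fderiv g x = Blinfun (frechet_derivative g (at x))"

text \<open>The set \<open>S\<close> is meant to be open.\<close>

definition C2_on :: "'a::real_normed_vector set \<Rightarrow> ('a \<Rightarrow> 'b::real_normed_vector) \<Rightarrow> bool"
  where "C2_on S g \<longleftrightarrow>
    (\<forall>x\<in>S. g differentiable (at x)) \<and>
    (\<forall>x\<in>S. fderiv g differentiable (at x)) \<and>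
    continuous_on S (fderiv (fderiv g))"

definition gradient :: "(real^'n \<Rightarrow> real) \<Rightarrow> real^'n \<Rightarrow> real^'n"
  where "gradient f x = (THE D. GDERIV f x :> D)"

definition hessian :: "(real^'n \<Rightarrow> real) \<Rightarrow> real^'n \<Rightarrow> real^'n^'n"
  where "hessian f x = jacobian (gradient f) (at x)"

definition is_pinv :: "real^'n^'m \<Rightarrow> real^'m^'n \<Rightarrow> bool"
  where "is_pinv A X \<longleftrightarrow>
    A ** X ** A = A \<and> X ** A ** X = X \<and>
    transpose (A ** X) = A ** X \<and> transpose (X ** A) = X ** A"

definition pinv :: "real^'n^'m \<Rightarrow> real^'m^'n"
  where "pinv A = (THE X. is_pinv A X)"

lemma is_pinv_unique:
  assumes "is_pinv A X" "is_pinv A Y"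
  shows "X = Y"
proof -
  note X = assms(1)[unfolded is_pinv_def] and Y = assms(2)[unfolded is_pinv_def]
  have AX_AY: "A ** X = A ** Y"
  proof -
    have "A ** X = transpose ((A ** Y ** A) ** X)" using X Y by simp
    also have "\<dots> = transpose ((A ** Y) ** (A ** X))" by (simp add: matrix_mul_assoc)
    also have "\<dots> = (A ** X) ** (A ** Y)" using X Y by (simp add: matrix_transpose_mul)
    also have "\<dots> = (A ** X ** A) ** Y" by (simp add: matrix_mul_assoc)
    also have "\<dots> = A ** Y" using X by simp
    finally show ?thesis .
  qed
  have XA_YA: "X ** A = Y ** A"
  proof -
    have "X ** A = transpose (X ** (A ** Y ** A))" using X Y by simp
    also have "\<dots> = transpose ((X ** A) ** (Y ** A))" by (simp add: matrix_mul_assoc)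
    also have "\<dots> = (Y ** A) ** (X ** A)" using X Y by (simp add: matrix_transpose_mul)
    also have "\<dots> = Y ** (A ** X ** A)" by (simp add: matrix_mul_assoc)
    also have "\<dots> = Y ** A" using X by simp
    finally show ?thesis .
  qed
  have "X = X ** A ** X" using X by simp
  also have "\<dots> = Y ** (A ** X)" using XA_YA by (simp add: matrix_mul_assoc)
  also have "\<dots> = Y ** A ** Y" using AX_AY by (simp add: matrix_mul_assoc)
  also have "\<dots> = Y" using Y by simp
  finally show ?thesis .
qed

lemma pinv_full_row_rank:
  fixes A :: "real^'n^'m"
  assumes "invertible (A ** transpose A)"
  shows "pinv A = transpose A ** matrix_inv (A ** transpose A)"
proof -
  define G where "G = matrix_inv (A ** transpose A)"
  have GG: "A ** transpose A ** G = mat 1" "G ** (A ** transpose A) = mat 1"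
    using assms someI_ex[of "\<lambda>B. A ** transpose A ** B = mat 1 \<and> B ** (A ** transpose A) = mat 1"]
    unfolding G_def matrix_inv_def invertible_def by auto
  have sym: "transpose G = G"
  proof -
    have "transpose G ** (A ** transpose A) = transpose (A ** transpose A ** G)"
      by (simp add: matrix_transpose_mul)
    hence "transpose G ** (A ** transpose A) = mat 1" using GG by (simp add: transpose_mat)
    hence "transpose G ** (A ** transpose A ** G) = mat 1 ** G" by (simp add: matrix_mul_assoc)
    thus ?thesis using GG by simp
  qed
  have 1: "A ** (transpose A ** G) = mat 1" using GG by (simp add: matrix_mul_assoc)
  have "is_pinv A (transpose A ** G)"
    unfolding is_pinv_def
  proof (intro conjI)
    show "A ** (transpose A ** G) ** A = A" using 1 by simp
    have "transpose A ** G ** A ** (transpose A ** G) = transpose A ** G ** (A ** (transpose A ** G))"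
      by (simp add: matrix_mul_assoc)
    thus "transpose A ** G ** A ** (transpose A ** G) = transpose A ** G" using 1 by simp
    show "transpose (A ** (transpose A ** G)) = A ** (transpose A ** G)" using 1 by (simp add: transpose_mat)
    show "transpose (transpose A ** G ** A) = transpose A ** G ** A"
      by (simp add: matrix_transpose_mul sym matrix_mul_assoc)
  qed
  thus ?thesis unfolding pinv_def G_def[symmetric]
    using is_pinv_unique by (blast intro: the_equality)
qed

text \<open>
  For \<open>CARD('m) \<le> CARD('n)\<close> the singular values of an \<open>m \<times> n\<close> matrix are the square roots of
  the eigenvalues of \<open>A ** transpose A\<close>. They form a finite nonempty set, so \<^const>\<open>Inf\<close> is the
  least of them.
\<close>

definition singular_values :: "real^'n^'m \<Rightarrow> real set"
  where "singular_values A =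
    {s. 0 \<le> s \<and> (\<exists>u. u \<noteq> 0 \<and> (A ** transpose A) *v u = s\<^sup>2 *\<^sub>R u)}"

definition sigma_min :: "real^'n^'m \<Rightarrow> real"
  where "sigma_min A = Inf (singular_values A)"

definition local_minimizer_on :: "('a::metric_space \<Rightarrow> real) \<Rightarrow> 'a set \<Rightarrow> 'a \<Rightarrow> bool"
  where "local_minimizer_on f M x \<longleftrightarrow> x \<in> M \<and> (\<exists>r>0. \<forall>y\<in>M \<inter> ball x r. f x \<le> f y)"

text \<open>
  Embedded submanifold of dimension \<open>d\<close> by slice charts, of the class \<open>C\<^sup>2\<close> of the constraint
  functions.
\<close>

definition C2_submanifold :: "nat \<Rightarrow> 'a::euclidean_space set \<Rightarrow> bool"
  where "C2_submanifold d M \<longleftrightarrow>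
    (\<forall>p\<in>M. \<exists>U V (\<phi> :: 'a \<Rightarrow> 'a) \<psi> T.
       open U \<and> p \<in> U \<and> open V \<and> homeomorphism U V \<phi> \<psi> \<and> C2_on U \<phi> \<and> C2_on V \<psi> \<and>
       subspace T \<and> dim T = d \<and> \<phi> ` (M \<inter> U) = T \<inter> V)"

definition tan_proj :: "(real^'n \<Rightarrow> real^'m) \<Rightarrow> real^'n \<Rightarrow> real^'n^'n"
  where "tan_proj F x = mat 1 - pinv (jacobian F (at x)) ** jacobian F (at x)"

definition nor_proj :: "(real^'n \<Rightarrow> real^'m) \<Rightarrow> real^'n \<Rightarrow> real^'n^'n"
  where "nor_proj F x = pinv (jacobian F (at x)) ** jacobian F (at x)"

definition riem_hessian :: "(real^'n \<Rightarrow> real) \<Rightarrow> (real^'n \<Rightarrow> real^'m) \<Rightarrow> real^'n \<Rightarrow> real^'n^'n"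
  where "riem_hessian f F x =
    tan_proj F x ** hessian f x ** tan_proj F x -
    (\<Sum>i\<in>UNIV. (transpose (pinv (jacobian F (at x))) *v gradient f x) $ i *\<^sub>R
       (tan_proj F x ** hessian (\<lambda>y. F y $ i) x ** tan_proj F x))"

definition unit_tangent :: "(real^'n \<Rightarrow> real^'m) \<Rightarrow> real^'n \<Rightarrow> (real^'n) set"
  where "unit_tangent F x = {u. norm u = 1 \<and> jacobian F (at x) *v u = 0}"

text \<open>
  Extended reals: when \<open>unit_tangent F x\<close> is empty, which happens for \<open>m = n\<close>, the supremum is
  \<open>-\<infinity>\<close> and the infimum is \<open>\<infinity>\<close>.
\<close>

definition lambda_max :: "(real^'n \<Rightarrow> real) \<Rightarrow> (real^'n \<Rightarrow> real^'m) \<Rightarrow> real^'n \<Rightarrow> ereal"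
  where "lambda_max f F x = (SUP u\<in>unit_tangent F x. ereal (u \<bullet> (riem_hessian f F x *v u)))"

definition lambda_min :: "(real^'n \<Rightarrow> real) \<Rightarrow> (real^'n \<Rightarrow> real^'m) \<Rightarrow> real^'n \<Rightarrow> ereal"
  where "lambda_min f F x = (INF u\<in>unit_tangent F x. ereal (u \<bullet> (riem_hessian f F x *v u)))"

definition kappa_R :: "(real^'n \<Rightarrow> real) \<Rightarrow> (real^'n \<Rightarrow> real^'m) \<Rightarrow> real^'n \<Rightarrow> real"
  where "kappa_R f F x = real_of_ereal (lambda_max f F x) / real_of_ereal (lambda_min f F x)"

definition sqp_iterates ::
    "(real^'n \<Rightarrow> real) \<Rightarrow> (real^'n \<Rightarrow> real^'m) \<Rightarrow> real \<Rightarrow> (nat \<Rightarrow> real^'n) \<Rightarrow> bool"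
  where "sqp_iterates f F \<eta> x \<longleftrightarrow>
    (\<forall>k. is_arg_min
       (\<lambda>y. f (x k) + gradient f (x k) \<bullet> (y - x k) + 1 / (2 * \<eta>) * (norm (y - x k))\<^sup>2)
       (\<lambda>y. F (x k) + jacobian F (at (x k)) *v (y - x k) = 0)
       (x (Suc k)))"

end

theory Submission
  imports Defs
begin

text \<open>
  Put \<open>e = x - x\<^sub>\<star>\<close>, \<open>\<lambda> = \<nabla>F(x\<^sub>\<star>)\<^sup>\<dagger>\<^sup>T \<nabla>f(x\<^sub>\<star>)\<close> and let \<open>g(x) = \<nabla>f(x) - \<nabla>F(x)\<^sup>T \<lambda>\<close> be the gradient of the
  Lagrangian with fixed multiplier. As \<open>P\<^sub>x\<close> kills the range of \<open>\<nabla>F(x)\<^sup>T\<close>, the step sends \<open>e\<close> to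
  \<open>P\<^sub>x (e - \<eta> g(x)) - \<nabla>F(x)\<^sup>\<dagger> (F(x) - \<nabla>F(x) e)\<close>. First-order optimality gives \<open>g(x\<^sub>\<star>) = 0\<close>, and
  \<open>P H P\<close> is the Riemannian Hessian when \<open>P = P\<^sub>x\<close> at \<open>x = x\<^sub>\<star>\<close> and \<open>H = g'(x\<^sub>\<star>)\<close>. Since \<open>P\<^sub>x - P = O(|e|)\<close>, the
  normal part of the new error is \<open>O(|e|\<^sup>2)\<close> and its tangential part is
  \<open>(P - \<eta> P H P) e + O(b) + o(|e|)\<close>, whose leading term is at most \<open>(1 - 1/\<kappa>) a\<close>. The slack between
  \<open>1 - 1/\<kappa>\<close> and \<open>1 - 1/(2\<kappa>)\<close> absorbs the error terms in \<open>a\<^sup>2 + \<sigma> b\<close>: first \<open>\<sigma>\<close> is chosen small,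
  then the radius, because \<open>a b\<close> and \<open>b\<^sup>2\<close> are at most the radius times \<open>b\<close>.
\<close>

subsection \<open>Pseudoinverses and kernel projections\<close>

lemma inner_transpose_mult:
  fixes A :: "real^'n^'m"
  shows "v \<bullet> (transpose A *v w) = (A *v v) \<bullet> w"
  by (metis dot_lmul_matrix inner_commute transpose_matrix_vector)

text \<open>A Cauchy-Schwarz argument for the semidefinite form of \<open>S\<close>, applied to
  \<open>u\<close> and \<open>S u\<close>, replaces the spectral theorem. It turns bounds on
  Rayleigh quotients into the contraction factor of
  \<open>projected_gradient_contraction\<close>.\<close>

lemma symmetric_PSD_norm_le:
  fixes S :: "'a::real_inner \<Rightarrow> 'a"
  assumes lin: "linear S" and sym: "\<And>u v. u \<bullet> S v = v \<bullet> S u"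
    and nonneg: "\<And>u. 0 \<le> u \<bullet> S u"
    and le: "\<And>u. u \<bullet> S u \<le> q * (norm u)\<^sup>2"
    and q: "0 \<le> q"
  shows "norm (S u) \<le> q * norm u"
proof -
  define w where "w = S u"
  have uw: "u \<bullet> S w = w \<bullet> w" using sym[of u w] by (simp add: w_def)
  \<comment> \<open>Nonnegativity of the form at \<open>c u - w\<close>; the optimal \<open>c\<close> is \<open>q\<close>, and \<open>c = 1\<close> serves when \<open>q = 0\<close>.\<close>
  have *: "0 \<le> c\<^sup>2 * (u \<bullet> S u) - 2 * c * (w \<bullet> w) + w \<bullet> S w" for c
  proof -
    have "0 \<le> (c *\<^sub>R u - w) \<bullet> S (c *\<^sub>R u - w)" by (rule nonneg)
    also have "S (c *\<^sub>R u - w) = c *\<^sub>R w - S w"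
      by (simp add: linear_diff[OF lin] linear_cmul[OF lin] w_def)
    also have "(c *\<^sub>R u - w) \<bullet> (c *\<^sub>R w - S w) = c\<^sup>2 * (u \<bullet> w) - 2 * c * (w \<bullet> w) + w \<bullet> S w"
      using uw by (simp add: inner_diff power2_eq_square algebra_simps)
    finally show ?thesis by (simp add: w_def)
  qed
  show ?thesis
  proof (cases "q = 0")
    case True
    have "u \<bullet> S u \<le> 0" "w \<bullet> S w \<le> 0" using le True by simp_all
    then have "w \<bullet> w \<le> 0" using *[of 1] by simp
    then have "w = 0" by (metis inner_gt_zero_iff not_le)
    then show ?thesis using True by (simp add: w_def)
  next
    case False
    have "q\<^sup>2 * (u \<bullet> S u) \<le> q\<^sup>2 * (q * (norm u)\<^sup>2)" using le[of u] by (intro mult_left_mono) auto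
    then have "0 \<le> q\<^sup>2 * (q * (norm u)\<^sup>2) - 2 * q * (norm w)\<^sup>2 + q * (norm w)\<^sup>2"
      using *[of q] le[of w] by (simp only: power2_norm_eq_inner)
    then have "q * (norm w)\<^sup>2 \<le> q * (q * norm u)\<^sup>2"
      by (simp add: power_mult_distrib mult.left_commute)
    then have "(norm w)\<^sup>2 \<le> (q * norm u)\<^sup>2" using False q by simp
    then show ?thesis unfolding w_def by (rule power2_le_imp_le) (use q in simp)
  qed
qed

text \<open>A nonzero kernel vector of the Gram matrix would make 0 a singular value. This converts
  the constraint qualification into full row rank, the form in which all pseudoinverse facts below
  take it.\<close>

lemma invertible_gram_if_sigma_min_pos:
  fixes A :: "real^'n^'m"
  assumes "0 < sigma_min A"
  shows "invertible (A ** transpose A)"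
proof (rule ccontr)
  assume "\<not> invertible (A ** transpose A)"
  then obtain u where u: "u \<noteq> 0" "(A ** transpose A) *v u = 0"
    by (metis invertible_left_inverse matrix_left_invertible_ker)
  then have "0 \<in> singular_values A" by (auto simp: singular_values_def)
  then have "sigma_min A \<le> 0" unfolding sigma_min_def
    by (rule cInf_lower) (auto simp: bdd_below_def singular_values_def)
  with assms show False by simp
qed

lemma mult_matrix_inv:
  fixes B :: "real^'n^'n"
  assumes "invertible B" shows "B ** matrix_inv B = mat 1"
proof -
  obtain C where "B ** C = mat 1 \<and> C ** B = mat 1" using assms by (auto simp: invertible_def)
  then show ?thesis
    unfolding matrix_inv_def by (rule someI[of "\<lambda>C. B ** C = mat 1 \<and> C ** B = mat 1", THEN conjunct1])
qed

context
  fixes A :: "real^'n^'m"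
  assumes inv: "invertible (A ** transpose A)"
begin

lemma pinv_right_inverse: "A ** pinv A = mat 1"
proof -
  have "A ** transpose A ** matrix_inv (A ** transpose A) = mat 1"
    using inv by (rule mult_matrix_inv)
  then show ?thesis by (simp only: pinv_full_row_rank[OF inv] matrix_mul_assoc)
qed

lemma mult_pinv [simp]: "A *v (pinv A *v w) = w"
  by (simp add: matrix_vector_mul_assoc pinv_right_inverse)

lemma pinv_in_range_transpose: "\<exists>u. pinv A *v w = transpose A *v u"
  unfolding pinv_full_row_rank[OF inv] matrix_vector_mul_assoc[symmetric] by blast

text \<open>The vectors \<open>pinv A *v w\<close> lie in the range of \<open>transpose A\<close>,
  which is orthogonal to the kernel of \<open>A\<close>.\<close>

lemma inner_pinv_kernel:
  assumes "A *v v = 0" shows "(pinv A *v w) \<bullet> v = 0"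
proof -
  obtain u where "pinv A *v w = transpose A *v u" using pinv_in_range_transpose by blast
  then have "(pinv A *v w) \<bullet> v = (A *v v) \<bullet> u"
    by (simp only: inner_commute[of "transpose A *v u" v] inner_transpose_mult)
  then show ?thesis using assms by simp
qed

text \<open>The Gram matrix is symmetric, so its inverse \<open>C\<close> is too, and the product of
  \<open>transpose A\<close>, \<open>C\<close> and \<open>A\<close> is then symmetric.\<close>

lemma transpose_pinv_mult: "transpose (pinv A ** A) = pinv A ** A"
proof -
  define B where "B = A ** transpose A"
  define C where "C = matrix_inv B"
  have BC: "B ** C = mat 1"
    using inv unfolding B_def[symmetric] C_def by (rule mult_matrix_inv)
  have "transpose B = B" by (simp add: B_def matrix_transpose_mul)
  then have CB: "transpose C ** B = mat 1"
    using matrix_transpose_mul[of B C] by (simp only: BC transpose_mat)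
  have "transpose C = transpose C ** (B ** C)" by (simp only: BC matrix_mul_rid)
  then have C: "transpose C = C" by (simp only: matrix_mul_assoc CB matrix_mul_lid)
  have "pinv A = transpose A ** C" using pinv_full_row_rank[OF inv] by (simp only: B_def C_def)
  then show ?thesis
    by (simp only: matrix_transpose_mul transpose_transpose C matrix_mul_assoc)
qed

text \<open>Pythagoras for the kernel of \<open>A\<close> and its orthogonal complement. At the
  minimizer it gives the identity between the squared error and the squares of its two
  parts.\<close>

lemma norm_split_pinv:
  "(norm (v - pinv A *v (A *v v)))\<^sup>2 + (norm (pinv A *v (A *v v)))\<^sup>2 = (norm v)\<^sup>2"
proof -
  have "A *v (v - pinv A *v (A *v v)) = 0" by (simp add: matrix_vector_mult_diff_distrib)
  then have "(pinv A *v (A *v v)) \<bullet> (v - pinv A *v (A *v v)) = 0" by (rule inner_pinv_kernel)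
  then show ?thesis
    by (simp add: power2_norm_eq_inner inner_diff inner_commute)
qed

lemma norm_kernel_part_le: "norm (v - pinv A *v (A *v v)) \<le> norm v"
  by (rule power2_le_imp_le) (use norm_split_pinv[of v] zero_le_power2[of "norm (pinv A *v (A *v v))"]
      zero_le_power2[of "norm (v - pinv A *v (A *v v))"] in linarith, rule norm_ge_zero)

lemma norm_pinv_mult_le: "norm (pinv A *v (A *v v)) \<le> norm v"
  by (rule power2_le_imp_le) (use norm_split_pinv[of v] zero_le_power2[of "norm (pinv A *v (A *v v))"]
      zero_le_power2[of "norm (v - pinv A *v (A *v v))"] in linarith, rule norm_ge_zero)

text \<open>The difference \<open>t\<close> of the two sides lies in the kernel of \<open>A\<close>
  and is orthogonal to both of them, so \<open>t\<close> is orthogonal to itself. This allows a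
  multiplier term to be subtracted from the gradient without changing the projected
  gradient.\<close>

lemma pinv_mult_transpose: "pinv A *v (A *v (transpose A *v w)) = transpose A *v w"
proof -
  define t where "t = transpose A *v w - pinv A *v (A *v (transpose A *v w))"
  have At: "A *v t = 0" by (simp add: t_def matrix_vector_mult_diff_distrib)
  have "t \<bullet> t = t \<bullet> (transpose A *v w) - (pinv A *v (A *v (transpose A *v w))) \<bullet> t"
    by (subst (2) t_def) (simp only: inner_diff_right inner_commute)
  also have "\<dots> = 0" by (simp only: inner_transpose_mult At inner_pinv_kernel[OF At] inner_zero_left diff_self)
  finally show ?thesis by (simp add: t_def)
qed

lemma pinv_mult_symmetric: "u \<bullet> (pinv A *v (A *v v)) = v \<bullet> (pinv A *v (A *v u))"
  using inner_transpose_mult[of u "pinv A ** A" v]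
  by (simp only: transpose_pinv_mult matrix_vector_mul_assoc[symmetric] inner_commute)

text \<open>On the affine feasible set the model exceeds its value at the candidate by exactly the
  squared distance to the candidate over \<open>2 * \<eta>\<close>. Existence and uniqueness of the
  minimizer follow together.\<close>

lemma sqp_step_iff:
  assumes eta: "0 < \<eta>"
  shows "is_arg_min (\<lambda>y. c + g \<bullet> (y - x) + 1 / (2 * \<eta>) * (norm (y - x))\<^sup>2)
      (\<lambda>y. b + A *v (y - x) = 0) y \<longleftrightarrow>
    y = x - \<eta> *\<^sub>R (g - pinv A *v (A *v g)) - pinv A *v b" (is "is_arg_min ?f ?P y \<longleftrightarrow> y = ?y")
proof -
  define s where "s = - (\<eta> *\<^sub>R (g - pinv A *v (A *v g))) - pinv A *v b"
  have As: "A *v s = - b"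
    by (simp add: s_def matrix_vector_mult_diff_distrib matrix_vector_mult_scaleR vec.neg)
  have y: "?y = x + s" by (simp add: s_def)
  \<comment> \<open>This is stationarity: the left side is \<open>\<eta>\<close> times the gradient
    of the model at the candidate, and the right side is orthogonal to every feasible
    direction.\<close>
  have range: "\<eta> *\<^sub>R g + s = pinv A *v (\<eta> *\<^sub>R (A *v g) - b)"
    by (simp add: s_def matrix_vector_mult_diff_distrib matrix_vector_mult_scaleR algebra_simps)
  have alg: "1 / (2 * \<eta>) * (N - 2 * \<eta> * G + D) = 1 / (2 * \<eta>) * N - G + 1 / (2 * \<eta>) * D"
    for N G D :: real
    using eta by (simp add: ring_distribs)
  have val: "?f (x + s + d) = ?f (x + s) + 1 / (2 * \<eta>) * (norm d)\<^sup>2" if d: "A *v d = 0" for d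
  proof -
    have "(\<eta> *\<^sub>R g + s) \<bullet> d = 0" using inner_pinv_kernel[OF d] by (simp only: range)
    then have "\<eta> * (g \<bullet> d) + s \<bullet> d = 0" by (simp add: inner_add_left)
    then have "s \<bullet> d = - (\<eta> * (g \<bullet> d))" by linarith
    then have "(norm (s + d))\<^sup>2 = (norm s)\<^sup>2 - 2 * \<eta> * (g \<bullet> d) + (norm d)\<^sup>2"
      by (simp only: power2_norm_eq_inner inner_add_left inner_add_right inner_commute[of d s])
    then have "1 / (2 * \<eta>) * (norm (s + d))\<^sup>2 =
        1 / (2 * \<eta>) * (norm s)\<^sup>2 - g \<bullet> d + 1 / (2 * \<eta>) * (norm d)\<^sup>2"
      by (simp only: alg)
    moreover have "x + s + d - x = s + d" "x + s - x = s" by simp_all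
    ultimately show ?thesis by (simp only: inner_add_right)
  qed
  have feas: "?P z \<longleftrightarrow> A *v (z - (x + s)) = 0" for z
  proof -
    have "A *v (z - (x + s)) = A *v (z - x) - A *v s"
      unfolding matrix_vector_mult_diff_distrib[symmetric] by (simp add: diff_diff_eq)
    then show ?thesis using As by (simp add: add.commute)
  qed
  have val': "?f z = ?f (x + s) + 1 / (2 * \<eta>) * (norm (z - (x + s)))\<^sup>2" if "?P z" for z
  proof -
    have "A *v (z - (x + s)) = 0" using that feas[of z] by blast
    moreover have "x + s + (z - (x + s)) = z" by (simp only: add_diff_cancel_left' add_diff_eq)
    ultimately show ?thesis using val[of "z - (x + s)"] by (simp only:)
  qed
  have "A *v ((x + s) - (x + s)) = 0" by (simp only: diff_self matrix_vector_mult_0_right)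
  then have P: "?P (x + s)" using feas[of "x + s"] by blast
  show ?thesis
    unfolding y
  proof
    assume "y = x + s"
    have "?f (x + s) \<le> ?f z" if "?P z" for z
    proof -
      have "0 \<le> 1 / (2 * \<eta>) * (norm (z - (x + s)))\<^sup>2" using eta by simp
      then show ?thesis using val'[OF that] by linarith
    qed
    with P \<open>y = x + s\<close> show "is_arg_min ?f ?P y" unfolding is_arg_min_linorder by blast
  next
    assume am: "is_arg_min ?f ?P y"
    then have "?P y" "?f y \<le> ?f (x + s)" using P unfolding is_arg_min_linorder by blast+
    then have "1 / (2 * \<eta>) * (norm (y - (x + s)))\<^sup>2 \<le> 0" using val'[of y] by linarith
    then have "(norm (y - (x + s)))\<^sup>2 \<le> 0" using eta by (simp add: divide_le_0_iff)
    then show "y = x + s" by simp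
  qed
qed

end

section \<open>Stability of pseudoinverses and projections under perturbation of the matrix\<close>

text \<open>The matrix \<open>A ** pinv B\<close> differs from the identity by
  \<open>(A - B) ** pinv B\<close>, of operator norm at most 1/2. Hence \<open>norm u\<close> is at
  most \<open>2 * K\<close> times the norm of \<open>transpose A *v u\<close>, and by duality the
  same constant bounds \<open>pinv A\<close>.\<close>

lemma pinv_norm_perturb:
  fixes A B :: "real^'n^'m"
  assumes A: "invertible (A ** transpose A)" and B: "invertible (B ** transpose B)"
    and K: "\<And>w. norm (pinv B *v w) \<le> K * norm w"
    and d: "\<And>v. norm ((A - B) *v v) \<le> d * norm v" and dK: "d * K \<le> 1/2" "0 \<le> d"
  shows "norm (pinv A *v w) \<le> 2 * K * norm w"
proof -
  obtain u where u: "pinv A *v w = transpose A *v u" using pinv_in_range_transpose[OF A] by blast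
  define z where "z = pinv A *v w"
  have zz: "(norm z)\<^sup>2 = u \<bullet> w"
    by (metis A inner_commute inner_transpose_mult mult_pinv power2_norm_eq_inner u z_def)
  have "(norm u)\<^sup>2 = u \<bullet> (A *v (pinv B *v u)) - u \<bullet> ((A - B) *v (pinv B *v u))"
    by (simp add: matrix_vector_mult_diff_rdistrib inner_diff mult_pinv[OF B] power2_norm_eq_inner)
  moreover have "u \<bullet> (A *v (pinv B *v u)) = (transpose A *v u) \<bullet> (pinv B *v u)"
    by (metis inner_commute inner_transpose_mult)
  moreover have "(transpose A *v u) \<bullet> (pinv B *v u) \<le> norm z * (K * norm u)"
    using norm_cauchy_schwarz[of "transpose A *v u" "pinv B *v u"] K[of u]
    unfolding z_def u by (meson mult_left_mono norm_ge_zero order_trans)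
  moreover have "- (u \<bullet> ((A - B) *v (pinv B *v u))) \<le> norm u * (d * (K * norm u))"
  proof -
    have "\<bar>u \<bullet> ((A - B) *v (pinv B *v u))\<bar> \<le> norm u * norm ((A - B) *v (pinv B *v u))"
      by (rule Cauchy_Schwarz_ineq2)
    also have "\<dots> \<le> norm u * (d * (K * norm u))"
      by (intro mult_left_mono order_trans[OF d] K dK) auto
    finally show ?thesis by linarith
  qed
  moreover have "norm u * (d * (K * norm u)) \<le> (norm u)\<^sup>2 / 2"
    using mult_right_mono[OF dK(1), of "(norm u)\<^sup>2"] by (simp add: power2_eq_square algebra_simps)
  ultimately have "(norm u)\<^sup>2 \<le> 2 * (norm z * (K * norm u))" by linarith
  then have "norm u * norm u \<le> (2 * K * norm z) * norm u" by (simp add: power2_eq_square algebra_simps)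
  then have nu: "norm u \<le> 2 * K * norm z \<or> u = 0" by auto
  show ?thesis
  proof (cases "z = 0")
    case True
    have "0 \<le> K * norm w" using K[of w] norm_ge_zero order_trans by blast
    then show ?thesis using True z_def by simp
  next
    case False
    then have "u \<noteq> 0" using zz by auto
    have "norm z * norm z \<le> norm u * norm w" 
      using zz norm_cauchy_schwarz[of u w] by (simp add: power2_eq_square)
    also have "\<dots> \<le> (2 * K * norm z) * norm w" using nu \<open>u \<noteq> 0\<close> by (intro mult_right_mono) auto
    finally have "norm z * norm z \<le> norm z * (2 * K * norm w)" by (simp add: algebra_simps)
    then show ?thesis using False z_def by simp
  qed
qed

text \<open>On the kernel part \<open>t\<close> the matrix \<open>B\<close> acts as
  \<open>B - A\<close>, since \<open>A\<close> annihilates \<open>t\<close>.\<close>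

lemma kernel_proj_perturb:
  fixes A B :: "real^'n^'m"
  assumes A: "invertible (A ** transpose A)" and B: "invertible (B ** transpose B)"
    and K: "\<And>w. norm (pinv B *v w) \<le> K * norm w" and K0: "0 \<le> K"
    and d: "\<And>v. norm ((A - B) *v v) \<le> d * norm v"
    and d0: "0 \<le> d"
  shows "norm (pinv B *v (B *v (v - pinv A *v (A *v v)))) \<le> K * d * norm v"
proof -
  define t where "t = v - pinv A *v (A *v v)"
  have At: "A *v t = 0" by (simp add: t_def matrix_vector_mult_diff_distrib mult_pinv[OF A])
  have "norm (pinv B *v (B *v t)) \<le> K * norm (B *v t)" by (rule K)
  also have "\<dots> \<le> K * (d * norm t)"
    using d[of t] K0 At by (intro mult_left_mono) (auto simp: matrix_vector_mult_diff_rdistrib)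
  also have "\<dots> \<le> K * (d * norm v)"
    using norm_kernel_part_le[OF A] K0 d0 by (intro mult_left_mono) (auto simp: t_def)
  finally show ?thesis by (simp only: t_def mult.assoc)
qed

text \<open>The adjoint of the previous estimate: both projections are self-adjoint, so the norm of
  the defect \<open>w\<close> is found by pairing it with itself and moving
  \<open>pinv A ** A\<close> to the other side.\<close>

lemma range_proj_perturb:
  fixes A B :: "real^'n^'m"
  assumes A: "invertible (A ** transpose A)" and B: "invertible (B ** transpose B)"
    and K: "\<And>w. norm (pinv A *v w) \<le> K * norm w" and K0: "0 \<le> K"
    and d: "\<And>v. norm ((A - B) *v v) \<le> d * norm v"
    and d0: "0 \<le> d"
  shows "norm (pinv A *v (A *v v) - pinv B *v (B *v (pinv A *v (A *v v)))) \<le> K * d * norm v"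
proof -
  define n where "n = pinv A *v (A *v v)"
  define w where "w = n - pinv B *v (B *v n)"
  have Bw: "B *v w = 0" by (simp add: w_def matrix_vector_mult_diff_distrib mult_pinv[OF B])
  have d': "norm ((B - A) *v v) \<le> d * norm v" for v
    using d[of v] by (metis matrix_vector_mult_diff_rdistrib norm_minus_commute)
  have "w \<bullet> w = w \<bullet> n - (pinv B *v (B *v n)) \<bullet> w" by (simp add: w_def inner_diff inner_commute)
  also have "(pinv B *v (B *v n)) \<bullet> w = 0" by (rule inner_pinv_kernel[OF B Bw])
  also have "w \<bullet> n = ((pinv A ** A) *v w) \<bullet> v"
    by (metis A inner_transpose_mult matrix_vector_mul_assoc n_def transpose_pinv_mult)
  also have "\<dots> = (pinv A *v (A *v w)) \<bullet> v" by (simp add: matrix_vector_mul_assoc)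
  also have "\<dots> \<le> norm (pinv A *v (A *v w)) * norm v" by (rule norm_cauchy_schwarz)
  \<comment> \<open>Since \<open>w\<close> is in the kernel of \<open>B\<close>, it equals its own
    kernel part, and the previous lemma applies with \<open>A\<close> and \<open>B\<close>
    exchanged.\<close>
  also have "norm (pinv A *v (A *v w)) \<le> K * d * norm w"
    using kernel_proj_perturb[OF B A K K0 d' d0, of w] Bw by simp
  finally have "norm w * norm w \<le> norm w * (K * d * norm v)"
    by (simp add: power2_norm_eq_inner[symmetric] power2_eq_square mult_right_mono algebra_simps)
  then show ?thesis using K0 d0 by (cases "w = 0") (auto simp: w_def n_def)
qed

subsection \<open>Gradients, Jacobians and first-order optimality\<close>

lemma has_derivative_fderiv:
  assumes "f differentiable (at x)"
  shows "(f has_derivative blinfun_apply (fderiv f x)) (at x)"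
  using assms unfolding fderiv_def
  by (metis bounded_linear_Blinfun_apply frechet_derivative_works has_derivative_bounded_linear)

lemma jacobian_mult_fderiv:
  fixes F :: "real^'n \<Rightarrow> real^'m"
  assumes "F differentiable (at x)"
  shows "jacobian F (at x) *v v = fderiv F x v"
proof -
  have "(F has_derivative (\<lambda>h. jacobian F (at x) *v h)) (at x)"
    using assms by (simp flip: jacobian_works)
  from has_derivative_unique[OF this has_derivative_fderiv[OF assms]] show ?thesis by metis
qed

lemma gradient_eqI:
  assumes "GDERIV f x :> D"
  shows "gradient f x = D"
  unfolding gradient_def
proof (rule the_equality)
  fix D' assume "GDERIV f x :> D'"
  with assms have "(\<lambda>h. h \<bullet> D') = (\<lambda>h. h \<bullet> D)"
    unfolding gderiv_def by (rule has_derivative_unique[rotated])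
  then have "\<forall>h. h \<bullet> D' = h \<bullet> D" by metis
  then show "D' = D" by (simp add: vector_eq_ldot)
qed (rule assms)

text \<open>The Riesz representation in coordinates. The representing vector depends linearly on
  \<open>fderiv f x\<close>, which later makes the gradient differentiable wherever
  \<open>fderiv f\<close> is.\<close>

lemma fderiv_eq_inner:
  fixes f :: "'a::euclidean_space \<Rightarrow> real"
  shows "fderiv f x h = h \<bullet> (\<Sum>b\<in>Basis. fderiv f x b *\<^sub>R b)"
proof -
  have "fderiv f x h = fderiv f x (\<Sum>b\<in>Basis. (h \<bullet> b) *\<^sub>R b)" by (simp add: euclidean_representation)
  also have "\<dots> = (\<Sum>b\<in>Basis. (h \<bullet> b) * fderiv f x b)"
    by (simp add: blinfun.sum_right blinfun.scaleR_right)
  finally show ?thesis by (simp add: inner_sum_right mult.commute)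
qed

lemma gradient_eq_sum_fderiv:
  fixes f :: "real^'n \<Rightarrow> real"
  assumes "f differentiable (at x)"
  shows "gradient f x = (\<Sum>b\<in>Basis. fderiv f x b *\<^sub>R b)"
  by (rule gradient_eqI)
    (use has_derivative_fderiv[OF assms] in \<open>simp add: gderiv_def flip: fderiv_eq_inner\<close>)

lemma has_derivative_gradient:
  fixes f :: "real^'n \<Rightarrow> real"
  assumes "f differentiable (at x)"
  shows "(f has_derivative (\<lambda>h. h \<bullet> gradient f x)) (at x)"
  using has_derivative_fderiv[OF assms] by (simp add: gradient_eq_sum_fderiv[OF assms] flip: fderiv_eq_inner)

text \<open>Both mixed derivatives are the limit of \<open>(f (x + t u + t v) - f (x + t u) - f (x + t v) + f x) / t\<^sup>2\<close>.\<close>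

lemma symmetric_second_derivative:
  fixes f :: "'a::real_inner \<Rightarrow> real"
  assumes f: "\<And>y. (f has_derivative (\<lambda>h. h \<bullet> G y)) (at y)"
    and G: "(G has_derivative H) (at x)"
  shows "u \<bullet> H v = v \<bullet> H u"
proof (rule ccontr)
  assume neq: "u \<bullet> H v \<noteq> v \<bullet> H u"
  define s where "s = norm u + norm v"
  have s: "0 < s" 
  proof -
    have "u \<noteq> 0 \<or> v \<noteq> 0" using neq by auto
    then show ?thesis unfolding s_def by (metis add_nonneg_pos add_pos_nonneg norm_ge_zero zero_less_norm_iff)
  qed
  \<comment> \<open>The factor 8 makes the final error bound \<open>4 * e * s * s\<close> equal to
    half of the supposed gap.\<close>
  define e where "e = \<bar>u \<bullet> H v - v \<bullet> H u\<bar> / (8 * s * s)"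
  have e: "0 < e" using neq s by (simp add: e_def)
  have linH: "linear H" using G by (rule has_derivative_linear)
  obtain d where d: "0 < d" and
    dG: "\<And>y. norm (y - x) < d \<Longrightarrow> norm (G y - G x - H (y - x)) \<le> e * norm (y - x)"
    using G e unfolding has_derivative_at_alt by blast
  \<comment> \<open>All points \<open>x + z *\<^sub>R a + c *\<^sub>R b\<close> with coefficients
    between 0 and \<open>t\<close> then lie within \<open>t * s = d / 2\<close> of \<open>x\<close>,
    inside the region where \<open>dG\<close> holds.\<close>
  define t where "t = d / (2 * s)"
  have t: "0 < t" using d s by (simp add: t_def)
  define D where "D = f (x + t *\<^sub>R u + t *\<^sub>R v) - f (x + t *\<^sub>R u) - f (x + t *\<^sub>R v) + f x"
  have main: "\<bar>f (x + t *\<^sub>R a + t *\<^sub>R b) - f (x + t *\<^sub>R a) - f (x + t *\<^sub>R b) + f x - t\<^sup>2 * (a \<bullet> H b)\<bar>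
      \<le> 2 * e * s * s * t\<^sup>2" if ab: "norm a + norm b = s" for a b
  proof -
    \<comment> \<open>The second difference of \<open>f\<close> is the increment of \<open>p\<close>
      over the interval from 0 to \<open>t\<close>. The mean value theorem reduces it to one
      difference of \<open>G\<close>, so differentiability of \<open>G\<close> at \<open>x\<close>
      alone suffices.\<close>
    define p where "p z = f (x + z *\<^sub>R a + t *\<^sub>R b) - f (x + z *\<^sub>R a)" for z
    have der: "DERIV p z :> a \<bullet> (G (x + z *\<^sub>R a + t *\<^sub>R b) - G (x + z *\<^sub>R a))" for z
    proof -
      have 1: "((\<lambda>z. f (x + z *\<^sub>R a + c)) has_derivative (\<lambda>h. (h *\<^sub>R a) \<bullet> G (x + z *\<^sub>R a + c))) (at z)" for c
        by (rule has_derivative_compose[OF _ f]) (auto intro!: derivative_eq_intros)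
      show ?thesis
        unfolding p_def has_field_derivative_def
        using has_derivative_diff[OF 1[of "t *\<^sub>R b"] 1[of 0, unfolded add_0_right]]
        by (rule has_derivative_eq_rhs) (auto simp: inner_diff algebra_simps)
    qed
    obtain z where z: "0 < z" "z < t" and
      pz: "p t - p 0 = (t - 0) * (a \<bullet> (G (x + z *\<^sub>R a + t *\<^sub>R b) - G (x + z *\<^sub>R a)))"
      using MVT2[OF t der] by blast
    have bound: "norm (G (x + z *\<^sub>R a + c *\<^sub>R b) - G x - H (z *\<^sub>R a + c *\<^sub>R b)) \<le> e * (t * s)"
      if c: "0 \<le> c" "c \<le> t" for c
    proof -
      have "norm (z *\<^sub>R a + c *\<^sub>R b) \<le> z * norm a + c * norm b"
        using z c norm_triangle_ineq[of "z *\<^sub>R a" "c *\<^sub>R b"] by simp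
      also have "\<dots> \<le> t * norm a + t * norm b"
        using z c by (intro add_mono mult_right_mono) auto
      finally have le: "norm (z *\<^sub>R a + c *\<^sub>R b) \<le> t * s" by (simp add: ab[symmetric] distrib_left)
      also have "t * s < d" using s d by (simp add: t_def)
      finally have "norm (x + z *\<^sub>R a + c *\<^sub>R b - x) < d" by (simp add: add.assoc)
      from dG[OF this] have "norm (G (x + z *\<^sub>R a + c *\<^sub>R b) - G x - H (z *\<^sub>R a + c *\<^sub>R b))
          \<le> e * norm (z *\<^sub>R a + c *\<^sub>R b)" by (simp add: add.assoc)
      also have "\<dots> \<le> e * (t * s)" using le e by simp
      finally show ?thesis .
    qed
    define g where "g = G (x + z *\<^sub>R a + t *\<^sub>R b) - G (x + z *\<^sub>R a) - H (t *\<^sub>R b)"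
    \<comment> \<open>Both values of \<open>G\<close> are expanded about \<open>x\<close>; the terms
      from \<open>z *\<^sub>R a\<close> cancel in the linear parts.\<close>
    have g_eq: "g = (G (x + z *\<^sub>R a + t *\<^sub>R b) - G x - H (z *\<^sub>R a + t *\<^sub>R b))
        - (G (x + z *\<^sub>R a + 0 *\<^sub>R b) - G x - H (z *\<^sub>R a + 0 *\<^sub>R b))"
      by (simp add: g_def linear_add[OF linH] linear_0[OF linH])
    have "norm g \<le> e * (t * s) + e * (t * s)"
      unfolding g_eq by (intro order_trans[OF norm_triangle_ineq4] add_mono bound) (use t in auto)
    then have g: "norm g \<le> 2 * e * s * t" by (simp add: algebra_simps)
    have "p t - p 0 - t\<^sup>2 * (a \<bullet> H b) = t * (a \<bullet> g)"
      unfolding pz g_def by (simp add: inner_diff linear_cmul[OF linH] power2_eq_square algebra_simps)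
    moreover have "\<bar>t * (a \<bullet> g)\<bar> \<le> t * (s * (2 * e * s * t))"
    proof -
      have "\<bar>a \<bullet> g\<bar> \<le> norm a * norm g" by (rule Cauchy_Schwarz_ineq2)
      also have "\<dots> \<le> s * (2 * e * s * t)"
        using g ab[symmetric] s by (intro mult_mono) auto
      finally show ?thesis using t by (simp add: abs_mult)
    qed
    ultimately show ?thesis
      by (simp add: p_def power2_eq_square algebra_simps)
  qed
  have 1: "\<bar>D - t\<^sup>2 * (u \<bullet> H v)\<bar> \<le> 2 * e * s * s * t\<^sup>2"
    using main[of u v] by (simp add: s_def D_def)
  have 2: "\<bar>D - t\<^sup>2 * (v \<bullet> H u)\<bar> \<le> 2 * e * s * s * t\<^sup>2"
    using main[of v u] by (simp add: s_def D_def algebra_simps)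
  have "\<bar>t\<^sup>2 * (u \<bullet> H v) - t\<^sup>2 * (v \<bullet> H u)\<bar> \<le> 4 * e * s * s * t\<^sup>2" using 1 2 by linarith
  then have "t\<^sup>2 * \<bar>u \<bullet> H v - v \<bullet> H u\<bar> \<le> t\<^sup>2 * (4 * e * s * s)"
    by (simp add: abs_mult flip: right_diff_distrib) (simp add: algebra_simps)
  then have "\<bar>u \<bullet> H v - v \<bullet> H u\<bar> \<le> 4 * e * s * s" using t by simp
  also have "\<dots> = \<bar>u \<bullet> H v - v \<bullet> H u\<bar> / 2" using s by (simp add: e_def)
  finally show False using neq by simp
qed

section \<open>Hessians and differentiability of gradients, for the objective and the constraint
  components\<close>

lemma has_derivative_hessian:
  assumes "gradient f differentiable (at x)"
  shows "(gradient f has_derivative (\<lambda>h. hessian f x *v h)) (at x)"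
  unfolding hessian_def using assms by (simp flip: jacobian_works)

lemma hessian_symmetric:
  fixes f :: "real^'n \<Rightarrow> real"
  assumes "\<And>y. f differentiable (at y)" and "gradient f differentiable (at x)"
  shows "u \<bullet> (hessian f x *v v) = v \<bullet> (hessian f x *v u)"
  using symmetric_second_derivative[OF has_derivative_gradient[OF assms(1)] has_derivative_hessian[OF assms(2)]] .

lemma differentiable_gradient:
  fixes f :: "real^'n \<Rightarrow> real"
  assumes "\<And>y. f differentiable (at y)" and "fderiv f differentiable (at x)"
  shows "gradient f differentiable (at x)"
proof -
  have "gradient f = (\<lambda>y. \<Sum>b\<in>Basis. fderiv f y b *\<^sub>R b)"
    using gradient_eq_sum_fderiv[OF assms(1)] by blast
  moreover have "(\<lambda>y. fderiv f y b *\<^sub>R b) differentiable (at x)" for b :: "real^'n"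
    by (rule differentiable_compose[OF _ assms(2), of "\<lambda>L. blinfun_apply L b *\<^sub>R b"])
      (intro bounded_linear_imp_differentiable bounded_linear_intros)
  ultimately show ?thesis by (auto intro!: differentiable_sum)
qed

lemma has_derivative_component_jacobian:
  fixes F :: "real^'n \<Rightarrow> real^'m"
  assumes "F differentiable (at y)"
  shows "((\<lambda>y. F y $ i) has_derivative (\<lambda>h. h \<bullet> (jacobian F (at y) $ i))) (at y)"
proof -
  have "(F has_derivative (\<lambda>h. jacobian F (at y) *v h)) (at y)"
    using assms by (simp flip: jacobian_works)
  from bounded_linear.has_derivative[OF bounded_linear_vec_nth this, of i]
  show ?thesis by (simp add: matrix_vector_mul_component inner_commute)
qed

lemma gradient_component:
  fixes F :: "real^'n \<Rightarrow> real^'m"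
  assumes "F differentiable (at y)"
  shows "gradient (\<lambda>y. F y $ i) y = jacobian F (at y) $ i"
  by (rule gradient_eqI) (use has_derivative_component_jacobian[OF assms] in \<open>simp add: gderiv_def\<close>)

lemma differentiable_gradient_component:
  fixes F :: "real^'n \<Rightarrow> real^'m"
  assumes F: "\<And>y. F differentiable (at y)" and F': "fderiv F differentiable (at x)"
  shows "gradient (\<lambda>y. F y $ i) differentiable (at x)"
proof -
  have Fi: "(\<lambda>y. F y $ i) differentiable (at y)" for y
    using has_derivative_component_jacobian[OF F] unfolding differentiable_def by blast
  have "gradient (\<lambda>y. F y $ i) y = (\<Sum>b\<in>Basis. (fderiv F y b $ i) *\<^sub>R b)" for y
  proof -
    have "fderiv (\<lambda>y. F y $ i) y b = fderiv F y b $ i" for b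
      using fun_cong[OF has_derivative_unique[OF has_derivative_fderiv[OF Fi[of y]] has_derivative_component_jacobian[OF F]], of b]
      by (simp add: matrix_vector_mul_component inner_commute flip: jacobian_mult_fderiv[OF F])
    then show ?thesis using gradient_eq_sum_fderiv[OF Fi] by simp
  qed
  then have "gradient (\<lambda>y. F y $ i) = (\<lambda>y. \<Sum>b\<in>Basis. (fderiv F y b $ i) *\<^sub>R b)" by blast
  moreover have "(\<lambda>y. (fderiv F y b $ i) *\<^sub>R b) differentiable (at x)" for b :: "real^'n"
    by (rule differentiable_compose[OF _ F', of "\<lambda>L. (blinfun_apply L b $ i) *\<^sub>R b"])
      (intro bounded_linear_imp_differentiable bounded_linear_intros
        bounded_linear_compose[OF bounded_linear_vec_nth])
  ultimately show ?thesis by (auto intro!: differentiable_sum)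
qed

lemma transpose_mult_eq_sum:
  fixes A :: "real^'n^'m"
  shows "transpose A *v w = (\<Sum>i\<in>UNIV. w $ i *\<^sub>R A $ i)"
  by (simp add: vec_eq_iff matrix_vector_mult_def transpose_def sum_component mult.commute)

section \<open>Quantitative first-order bounds for the constraint map\<close>

text \<open>The bound is expressed through the action on vectors because the Lipschitz constant
  refers to the operator norm, whereas the norm of the matrix type is the Frobenius norm.\<close>

lemma jacobian_lipschitz:
  fixes F :: "real^'n \<Rightarrow> real^'m"
  assumes F: "\<And>y. F differentiable (at y)" and L: "\<beta>-lipschitz_on S (fderiv F)"
    and xy: "x \<in> S" "y \<in> S"
  shows "norm ((jacobian F (at x) - jacobian F (at y)) *v v) \<le> \<beta> * norm (x - y) * norm v"
proof -
  have "(jacobian F (at x) - jacobian F (at y)) *v v = (fderiv F x - fderiv F y) v"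
    by (simp add: matrix_vector_mult_diff_rdistrib jacobian_mult_fderiv[OF F] blinfun.diff_left)
  also have "norm \<dots> \<le> norm (fderiv F x - fderiv F y) * norm v" by (rule norm_blinfun)
  also have "\<dots> \<le> \<beta> * norm (x - y) * norm v"
    using lipschitz_onD[OF L xy] by (intro mult_right_mono) (auto simp: dist_norm)
  finally show ?thesis .
qed

text \<open>The mean value inequality on the segment from \<open>z\<close> to \<open>x\<close>. The
  derivative is frozen at \<open>x\<close>, as in a Newton correction: later \<open>x\<close> is the
  current iterate and \<open>z\<close> the minimizer.\<close>

lemma linearization_error:
  fixes F :: "real^'n \<Rightarrow> real^'m"
  assumes F: "\<And>y. F differentiable (at y)" and L: "\<beta>-lipschitz_on S (fderiv F)"
    and S: "convex S" and xz: "x \<in> S" "z \<in> S"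
  shows "norm (F x - F z - jacobian F (at x) *v (x - z)) \<le> \<beta> * (norm (x - z))\<^sup>2"
proof -
  have "norm (F x - F z - blinfun_apply (fderiv F x) (x - z)) \<le> norm (x - z) * (\<beta> * norm (x - z))"
  proof (rule differentiable_bound_linearization[where S = "closed_segment z x"])
    show "z + t *\<^sub>R (x - z) \<in> closed_segment z x" if "t \<in> {0..1}" for t
      using that by (auto simp: closed_segment_def algebra_simps intro!: exI[of _ t])
    show "(F has_derivative blinfun_apply (fderiv F y)) (at y within closed_segment z x)" for y
      using has_derivative_fderiv[OF F] by (rule has_derivative_at_withinI)
    show "onorm (blinfun_apply (fderiv F y) - blinfun_apply (fderiv F x)) \<le> \<beta> * norm (x - z)"
      if y: "y \<in> closed_segment z x" for y
    proof -
      have "y \<in> S" using closed_segment_subset[OF xz(2,1) S] y by blast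
      have "blinfun_apply (fderiv F y) - blinfun_apply (fderiv F x) = blinfun_apply (fderiv F y - fderiv F x)"
        by (auto simp: blinfun.diff_left)
      then have "onorm (blinfun_apply (fderiv F y) - blinfun_apply (fderiv F x)) = norm (fderiv F y - fderiv F x)"
        by (simp add: norm_blinfun.rep_eq)
      also have "\<dots> \<le> \<beta> * norm (y - x)"
        using lipschitz_onD[OF L \<open>y \<in> S\<close> xz(1)] by (simp add: dist_norm)
      also have "\<dots> \<le> \<beta> * norm (x - z)"
        using segment_bound(2)[OF y] lipschitz_on_nonneg[OF L] by (intro mult_left_mono) (auto simp: norm_minus_commute)
      finally show ?thesis .
    qed
  qed auto
  then show ?thesis by (simp add: jacobian_mult_fderiv[OF F] power2_eq_square mult.left_commute)
qed

text \<open>The multiplier rule by an open mapping argument instead of curves in the constraint set: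
  if the tangential part \<open>v\<close> of the gradient were nonzero, some nearby point would keep
  \<open>F\<close> fixed and lower \<open>f\<close>.\<close>

lemma local_minimizer_gradient:
  fixes f :: "real^'n \<Rightarrow> real" and F :: "real^'n \<Rightarrow> real^'m"
  assumes f: "\<And>y. f differentiable (at y)" and F: "\<And>y. F differentiable (at y)"
    and inv: "invertible (jacobian F (at x) ** transpose (jacobian F (at x)))"
    and min: "local_minimizer_on f {x. F x = 0} x"
  shows "gradient f x = pinv (jacobian F (at x)) *v (jacobian F (at x) *v gradient f x)"
proof (rule ccontr)
  define J g where "J = jacobian F (at x)" and "g = gradient f x"
  define v where "v = g - pinv J *v (J *v g)"
  assume "gradient f x \<noteq> pinv (jacobian F (at x)) *v (jacobian F (at x) *v gradient f x)"
  then have v0: "v \<noteq> 0" by (simp add: v_def J_def g_def)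
  have invJ: "invertible (J ** transpose J)" using inv by (simp add: J_def)
  have Jv: "J *v v = 0" by (simp add: v_def matrix_vector_mult_diff_distrib mult_pinv[OF invJ])
  have vg: "v \<bullet> g = v \<bullet> v"
  proof -
    have "v \<bullet> g = v \<bullet> v + (pinv J *v (J *v g)) \<bullet> v" by (simp add: v_def inner_diff inner_commute)
    then show ?thesis by (simp add: inner_pinv_kernel[OF invJ Jv])
  qed
  obtain r where r: "0 < r" "\<And>y. F y = 0 \<Longrightarrow> y \<in> ball x r \<Longrightarrow> f x \<le> f y" and Fx: "F x = 0"
    using min unfolding local_minimizer_on_def by auto
  \<comment> \<open>If \<open>v \<noteq> 0\<close>, the derivative of \<open>(F, f)\<close> is onto, so \<open>(F, f)\<close> is open at \<open>x\<close>.\<close>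
  define R where "R p = pinv J *v fst p + ((snd p - (pinv J *v fst p) \<bullet> g) / (v \<bullet> v)) *\<^sub>R v"
    for p :: "(real^'m) \<times> real"
  have "(F x, f x) \<in> interior ((\<lambda>y. (F y, f y)) ` ball x r)"
  proof (rule sussmann_open_mapping[where S = UNIV and f' = "\<lambda>h. (J *v h, h \<bullet> g)" and g' = R])
    have "F differentiable_on UNIV" "f differentiable_on UNIV" using F f by (auto simp: differentiable_on_def)
    then show "continuous_on UNIV (\<lambda>y. (F y, f y))"
      by (intro continuous_on_Pair differentiable_imp_continuous_on)
    have "(F has_derivative (\<lambda>h. J *v h)) (at x)" unfolding J_def using F by (simp flip: jacobian_works)
    then show "((\<lambda>y. (F y, f y)) has_derivative (\<lambda>h. (J *v h, h \<bullet> g))) (at x)"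
      using has_derivative_gradient[OF f] unfolding g_def by (rule has_derivative_Pair)
    have "linear R"
      by (rule linearI) (simp_all add: R_def matrix_vector_right_distrib matrix_vector_mult_scaleR
          inner_add_left add_divide_distrib diff_divide_distrib algebra_simps scaleR_add_left)
    then show "bounded_linear R" by (rule linear_conv_bounded_linear[THEN iffD1])
    \<comment> \<open>The term \<open>pinv J *v fst p\<close> produces the first component. A
      multiple of \<open>v\<close> then corrects the second one, because \<open>J *v v = 0\<close>
      and \<open>v \<bullet> g = v \<bullet> v\<close>.\<close>
    show "(\<lambda>h. (J *v h, h \<bullet> g)) \<circ> R = id"
      using v0 Jv vg by (auto simp: R_def matrix_vector_right_distrib matrix_vector_mult_scaleR
          mult_pinv[OF invJ] inner_add_left)
    show "x \<in> interior (ball x r)" using r by simp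
  qed auto
  then obtain e where e: "0 < e" "ball (F x, f x) e \<subseteq> (\<lambda>y. (F y, f y)) ` ball x r"
    using mem_interior by blast
  have "(F x, f x - e / 2) \<in> ball (F x, f x) e" using e by (simp add: dist_Pair_Pair dist_real_def)
  then obtain y where "y \<in> ball x r" "F y = F x" "f y = f x - e / 2" using e by auto
  with r(2)[of y] Fx e show False by simp
qed

subsection \<open>Perturbation of the step and the Lyapunov function\<close>

text \<open>One step in terms of matrices: \<open>A\<close> and \<open>B\<close> stand for the
  Jacobians at the iterate and at the minimizer, \<open>e\<close> and \<open>s\<close> for the old
  and new errors, \<open>c\<close> for the constraint value and \<open>w\<close> for the multiplier.
  The new error is the kernel part for \<open>A\<close> of the Lagrangian gradient step
  \<open>y\<close>, minus a Newton remainder \<open>r\<close>. Replacing the projection for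
  \<open>A\<close> by the one for \<open>B\<close> costs a factor of order
  \<open>norm e\<close>.\<close>

lemma sqp_map_estimate:
  fixes A B :: "real^'n^'m" and H :: "real^'n^'n"
  assumes A: "invertible (A ** transpose A)" and B: "invertible (B ** transpose B)"
    and K: "\<And>w. norm (pinv B *v w) \<le> K * norm w" "0 \<le> K"
    and d: "\<And>v. norm ((A - B) *v v) \<le> \<beta> * norm e * norm v" and \<beta>: "0 \<le> \<beta>"
    and small: "\<beta> * norm e * K \<le> 1 / 2"
    and c: "norm (c - A *v e) \<le> \<beta> * (norm e)\<^sup>2"
    and h: "\<And>v. norm (H *v v) \<le> h * norm v" and \<eta>: "0 \<le> \<eta>"
    and g: "norm (g - transpose A *v w - H *v e) \<le> \<tau> * norm e" and \<tau>: "\<tau> \<le> 1"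
    and P: "\<And>v. P v = v - pinv B *v (B *v v)"
    and contr: "norm (P (P e) - \<eta> *\<^sub>R P (H *v P e)) \<le> q * norm (P e)"
  defines "s \<equiv> e - \<eta> *\<^sub>R (g - pinv A *v (A *v g)) - pinv A *v c"
    and "M \<equiv> 2 * K * \<beta> * (2 + \<eta> * (h + 1))"
  shows "norm (pinv B *v (B *v s)) \<le> M * (norm e)\<^sup>2"
    and "norm (P s) \<le> q * norm (P e) + \<eta> * h * norm (pinv B *v (B *v e)) + \<eta> * \<tau> * norm e
      + M * (norm e)\<^sup>2"
proof -
  define g' where "g' = g - transpose A *v w"
  define y where "y = e - \<eta> *\<^sub>R g'"
  define r where "r = pinv A *v (c - A *v e)"
  have proj: "g - pinv A *v (A *v g) = g' - pinv A *v (A *v g')"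
    using pinv_mult_transpose[OF A, of w] by (simp add: g'_def matrix_vector_mult_diff_distrib)
  \<comment> \<open>The normal part of \<open>e\<close> is absorbed into the Newton term, so that
    \<open>r\<close> contains only the linearization error \<open>c - A *v e\<close>.\<close>
  then have s: "s = y - pinv A *v (A *v y) - r"
    unfolding s_def proj by (simp add: y_def r_def matrix_vector_mult_diff_distrib matrix_vector_mult_scaleR algebra_simps)
  have d0: "0 \<le> \<beta> * norm e" using \<beta> by simp
  have h0: "0 \<le> h"
    using h[of "axis undefined 1"] by (simp add: norm_axis_1 order_trans[OF norm_ge_zero])
  have KA: "norm (pinv A *v v) \<le> 2 * K * norm v" for v
    using pinv_norm_perturb[OF A B K(1) d small d0] .
  have r: "norm r \<le> 2 * K * \<beta> * (norm e)\<^sup>2"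
  proof -
    have "norm r \<le> 2 * K * norm (c - A *v e)" unfolding r_def by (rule KA)
    also have "\<dots> \<le> 2 * K * (\<beta> * (norm e)\<^sup>2)" using c K(2) by (intro mult_left_mono) auto
    finally show ?thesis by (simp add: mult.assoc)
  qed
  have "norm g' \<le> norm (g' - H *v e) + norm (H *v e)"
    using norm_triangle_ineq[of "g' - H *v e" "H *v e"] by simp
  also have "\<dots> \<le> \<tau> * norm e + h * norm e" using g h[of e] by (intro add_mono) (auto simp: g'_def)
  also have "\<dots> \<le> (h + 1) * norm e"
    using mult_right_mono[OF \<tau> norm_ge_zero[of e]] by (simp add: distrib_right)
  finally have "\<eta> * norm g' \<le> \<eta> * ((h + 1) * norm e)" using \<eta> by (rule mult_left_mono)
  then have y: "norm y \<le> (1 + \<eta> * (h + 1)) * norm e"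
    using norm_triangle_ineq4[of e "\<eta> *\<^sub>R g'"] \<eta> by (simp add: y_def distrib_right mult.assoc)
  have Ky: "2 * K * (\<beta> * norm e) * norm y \<le> 2 * K * \<beta> * (1 + \<eta> * (h + 1)) * (norm e)\<^sup>2"
    using mult_left_mono[OF y, of "2 * K * (\<beta> * norm e)"] K(2) \<beta>
    by (simp add: power2_eq_square mult_ac)
  \<comment> \<open>In the factor \<open>2 + \<eta> * (h + 1)\<close> of \<open>M\<close>, the share
    \<open>1 + \<eta> * (h + 1)\<close> pays for changing projections at \<open>y\<close>, and the
    remaining 1 pays for \<open>r\<close>.\<close>
  have M: "2 * K * \<beta> * (1 + \<eta> * (h + 1)) * (norm e)\<^sup>2 + 2 * K * \<beta> * (norm e)\<^sup>2 = M * (norm e)\<^sup>2"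
    by (simp add: M_def algebra_simps)
  have "norm (pinv B *v (B *v s)) \<le> norm (pinv B *v (B *v (y - pinv A *v (A *v y))))
      + norm (pinv B *v (B *v r))"
    unfolding s using norm_triangle_ineq4 by (simp only: matrix_vector_mult_diff_distrib)
  also have "\<dots> \<le> K * (\<beta> * norm e) * norm y + norm r"
    by (intro add_mono kernel_proj_perturb[OF A B K d d0] norm_pinv_mult_le[OF B])
  \<comment> \<open>The constant \<open>K\<close> is doubled to match the tangential estimate below,
    where \<open>KA\<close> bounds \<open>pinv A\<close> by \<open>2 * K\<close>.\<close>
  also have "\<dots> \<le> 2 * K * (\<beta> * norm e) * norm y + 2 * K * \<beta> * (norm e)\<^sup>2"
    using r K(2) \<beta> by (intro add_mono mult_right_mono) auto
  finally show "norm (pinv B *v (B *v s)) \<le> M * (norm e)\<^sup>2" using Ky M by linarith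
  have linP: "linear P"
    unfolding P by (rule linearI)
      (simp_all add: matrix_vector_right_distrib matrix_vector_mult_scaleR algebra_simps)
  have Ple: "norm (P v) \<le> norm v" for v unfolding P by (rule norm_kernel_part_le[OF B])
  define n where "n = pinv B *v (B *v e)"
  have e: "e = P e + n" by (simp add: P n_def)
  have PP: "P (P e) = P e" by (simp add: P matrix_vector_mult_diff_distrib mult_pinv[OF B])
  have "H *v e = H *v P e + H *v n" by (metis e matrix_vector_right_distrib)
  \<comment> \<open>The three terms are the contraction on the tangential part, the coupling of the
    normal part through \<open>H\<close>, and the remainder of the Lagrangian gradient.\<close>
  then have Py: "P y = (P (P e) - \<eta> *\<^sub>R P (H *v P e)) - \<eta> *\<^sub>R P (H *v n) - \<eta> *\<^sub>R P (g' - H *v e)"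
    by (simp add: y_def PP linear_diff[OF linP] linear_add[OF linP] linear_cmul[OF linP] algebra_simps)
  have "norm (P y) \<le> norm (P (P e) - \<eta> *\<^sub>R P (H *v P e)) + norm (\<eta> *\<^sub>R P (H *v n))
      + norm (\<eta> *\<^sub>R P (g' - H *v e))"
    unfolding Py by (intro order_trans[OF norm_triangle_ineq4] add_mono order_refl)
  also have "\<dots> \<le> q * norm (P e) + \<eta> * (h * norm n) + \<eta> * (\<tau> * norm e)"
    using contr \<eta> g h[of n]
    by (intro add_mono) (auto intro!: mult_left_mono order_trans[OF Ple] simp: g'_def)
  finally have Py: "norm (P y) \<le> q * norm (P e) + \<eta> * (h * norm n) + \<eta> * (\<tau> * norm e)" .
  have "norm (P s) \<le> norm (P y) + norm (P (pinv A *v (A *v y))) + norm (P r)"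
    unfolding s linear_diff[OF linP]
    by (intro order_trans[OF norm_triangle_ineq4] add_mono order_refl)
  also have "\<dots> \<le> norm (P y) + 2 * K * (\<beta> * norm e) * norm y + 2 * K * \<beta> * (norm e)\<^sup>2"
    unfolding P[of "pinv A *v (A *v y)"]
    using range_proj_perturb[OF A B KA _ d d0, of y] K(2) order_trans[OF Ple r] by simp
  finally show "norm (P s) \<le> q * norm (P e) + \<eta> * h * norm (pinv B *v (B *v e)) + \<eta> * \<tau> * norm e
      + M * (norm e)\<^sup>2"
    using Py Ky M by (simp add: n_def mult.assoc)
qed

section \<open>Decrease of the Lyapunov function and its iteration\<close>

text \<open>The normal error enters linearly and the tangential one squared because a step makes the
  normal error quadratically small. The terms \<open>a * b\<close> and \<open>b\<^sup>2\<close> are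
  then of higher order than \<open>\<sigma> * b\<close> near \<open>xs\<close>.\<close>

lemma lyapunov_decrease:
  fixes xs :: "'a::real_normed_vector"
  assumes ab: "\<And>x. (norm (x - xs))\<^sup>2 = (a x)\<^sup>2 + (b x)\<^sup>2" "\<And>x. 0 \<le> a x" "\<And>x. 0 \<le> b x"
    and q: "0 \<le> q" "q < p" and C: "0 \<le> C"
    and est: "\<And>\<tau>. 0 < \<tau> \<Longrightarrow> \<exists>r>0. \<forall>x\<in>ball xs r. b (\<Phi> x) \<le> C * (norm (x - xs))\<^sup>2 \<and>
      a (\<Phi> x) \<le> q * a x + C * b x + \<tau> * norm (x - xs)"
    and R: "0 < R"
  obtains \<sigma> r where "0 < \<sigma>" "0 < r" "r \<le> R"
    "\<And>x. x \<in> ball xs r \<Longrightarrow> (a (\<Phi> x))\<^sup>2 + \<sigma> * b (\<Phi> x) \<le> p\<^sup>2 * ((a x)\<^sup>2 + \<sigma> * b x)"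
proof -
  \<comment> \<open>The gap between \<open>q\<close> and \<open>p\<close> is halved:
    \<open>\<tau>\<close> raises the tangential factor to the midpoint \<open>q1\<close>, and the
    rest leaves room for the weighted normal error.\<close>
  define q1 where "q1 = (q + p) / 2"
  define \<tau> where "\<tau> = (p - q) / 2"
  have \<tau>: "0 < \<tau>" "q + \<tau> = q1" and q1: "0 \<le> q1" "q1 < p"
    using q by (auto simp: \<tau>_def q1_def field_simps)
  have pq: "0 < p\<^sup>2 - q1\<^sup>2" using q1 by (simp add: power_strict_mono)
  \<comment> \<open>With this weight the contribution \<open>\<sigma> * C\<close> to the coefficient
    of \<open>a\<^sup>2\<close> fits between \<open>q1\<^sup>2\<close> and \<open>p\<^sup>2\<close>.
    The summand 1 covers \<open>C = 0\<close>.\<close>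
  define \<sigma> where "\<sigma> = (p\<^sup>2 - q1\<^sup>2) / (C + 1)"
  have \<sigma>: "0 < \<sigma>" using pq C by (simp add: \<sigma>_def)
  have \<sigma>C: "q1\<^sup>2 + \<sigma> * C \<le> p\<^sup>2"
  proof -
    have "\<sigma> * (C + 1) = p\<^sup>2 - q1\<^sup>2" using C by (simp add: \<sigma>_def)
    then show ?thesis using \<sigma> by (simp add: distrib_left)
  qed
  \<comment> \<open>\<open>D\<close> collects the coefficients of \<open>r * b\<close>: from the
    cross term, from the squared normal term, and from the new normal error weighted by
    \<open>\<sigma>\<close>.\<close>
  define D where "D = 2 * q1 * (C + \<tau>) + (C + \<tau>)\<^sup>2 + \<sigma> * C"
  have D: "0 \<le> D" using q1 C \<tau> \<sigma> by (simp add: D_def)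
  obtain r0 where r0: "0 < r0" and est': "\<And>x. x \<in> ball xs r0 \<Longrightarrow> b (\<Phi> x) \<le> C * (norm (x - xs))\<^sup>2"
    "\<And>x. x \<in> ball xs r0 \<Longrightarrow> a (\<Phi> x) \<le> q * a x + C * b x + \<tau> * norm (x - xs)"
    using est[OF \<tau>(1)] by blast
  define r where "r = min R (min r0 (p\<^sup>2 * \<sigma> / (D + 1)))"
  have p: "0 < p" using q by simp
  have r: "0 < r" "r \<le> r0" "r \<le> R" using R r0 p \<sigma> D by (auto simp: r_def)
  have "r \<le> p\<^sup>2 * \<sigma> / (D + 1)" by (simp add: r_def)
  then have "r * (D + 1) \<le> p\<^sup>2 * \<sigma>" using D by (simp add: pos_le_divide_eq)
  then have rD: "D * r \<le> p\<^sup>2 * \<sigma>" using r by (simp add: algebra_simps)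
  show ?thesis
  proof (rule that[OF \<sigma> r(1) r(3)])
    fix x assume x: "x \<in> ball xs r"
    then have nr: "norm (x - xs) \<le> r" by (simp add: dist_norm norm_minus_commute)
    have x0: "x \<in> ball xs r0" using x r by auto
    let ?a = "a x" and ?b = "b x"
    note a0 = ab(2)[of x] and b0 = ab(3)[of x]
    have b_le: "?b \<le> r" 
      by (rule order_trans[OF _ nr], rule power2_le_imp_le) (simp_all add: ab(1))
    have a_le: "?a \<le> r"
      by (rule order_trans[OF _ nr], rule power2_le_imp_le) (simp_all add: ab(1))
    have n_le: "norm (x - xs) \<le> ?a + ?b"
      by (rule power2_le_imp_le) (use a0 b0 in \<open>simp_all add: ab(1) power2_sum\<close>)
    have "a (\<Phi> x) \<le> q * ?a + C * ?b + \<tau> * (?a + ?b)"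
      using est'(2)[OF x0] mult_left_mono[OF n_le, of \<tau>] \<tau>(1) by linarith
    also have "\<dots> = q1 * ?a + (C + \<tau>) * ?b" unfolding \<tau>(2)[symmetric] by (simp add: algebra_simps)
    finally have "(a (\<Phi> x))\<^sup>2 \<le> (q1 * ?a + (C + \<tau>) * ?b)\<^sup>2" using ab(2) by (intro power_mono)
    also have "\<dots> = q1\<^sup>2 * ?a\<^sup>2 + 2 * q1 * (C + \<tau>) * (?a * ?b) + (C + \<tau>)\<^sup>2 * (?b * ?b)"
      by (simp add: power2_eq_square algebra_simps)
    also have "\<dots> \<le> q1\<^sup>2 * ?a\<^sup>2 + 2 * q1 * (C + \<tau>) * (r * ?b) + (C + \<tau>)\<^sup>2 * (r * ?b)"
      using a_le b_le b0 q1 C \<tau> by (intro add_mono mult_left_mono mult_right_mono order_refl) auto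
    finally have 1: "(a (\<Phi> x))\<^sup>2 \<le> q1\<^sup>2 * ?a\<^sup>2 + 2 * q1 * (C + \<tau>) * (r * ?b) + (C + \<tau>)\<^sup>2 * (r * ?b)" .
    have "b (\<Phi> x) \<le> C * (?a\<^sup>2 + ?b * ?b)" using est'(1)[OF x0] by (simp add: ab(1) power2_eq_square[of ?b])
    also have "\<dots> \<le> C * (?a\<^sup>2 + r * ?b)"
      using b_le b0 C by (intro mult_left_mono add_mono mult_right_mono order_refl) auto
    finally have 2: "\<sigma> * b (\<Phi> x) \<le> \<sigma> * (C * (?a\<^sup>2 + r * ?b))" using \<sigma> by simp
    have "(a (\<Phi> x))\<^sup>2 + \<sigma> * b (\<Phi> x) \<le> (q1\<^sup>2 + \<sigma> * C) * ?a\<^sup>2 + (D * r) * ?b"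
      using 1 2 by (simp add: D_def algebra_simps)
    also have "\<dots> \<le> p\<^sup>2 * ?a\<^sup>2 + (p\<^sup>2 * \<sigma>) * ?b"
      using \<sigma>C rD b0 by (intro add_mono mult_right_mono) auto
    finally show "(a (\<Phi> x))\<^sup>2 + \<sigma> * b (\<Phi> x) \<le> p\<^sup>2 * ((a x)\<^sup>2 + \<sigma> * b x)" by (simp add: algebra_simps)
  qed
qed

text \<open>A sublevel set of \<open>V\<close> is invariant under \<open>\<Phi>\<close> and lies
  between the balls of radius \<open>\<epsilon>\<close> and \<open>r\<close>. The recursion is
  required only inside the larger ball, so it fits sequences of minimizers whose closed form is
  known only there.\<close>

lemma lyapunov_iteration:
  fixes xs :: "'a::real_normed_vector"
  assumes ab: "\<And>x. (norm (x - xs))\<^sup>2 = (a x)\<^sup>2 + (b x)\<^sup>2" "\<And>x. 0 \<le> a x" "\<And>x. 0 \<le> b x"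
    and p: "0 \<le> p" "p \<le> 1" and \<sigma>: "0 < \<sigma>" and r: "0 < r"
    and dec: "\<And>x. x \<in> ball xs r \<Longrightarrow> (a (\<Phi> x))\<^sup>2 + \<sigma> * b (\<Phi> x) \<le> p\<^sup>2 * ((a x)\<^sup>2 + \<sigma> * b x)"
  obtains \<epsilon> where "0 < \<epsilon>"
    "\<And>x k. x 0 \<in> ball xs \<epsilon> \<Longrightarrow> (\<And>k. x k \<in> ball xs r \<Longrightarrow> x (Suc k) = \<Phi> (x k)) \<Longrightarrow> x k \<in> ball xs r"
    "\<And>x. x 0 \<in> ball xs \<epsilon> \<Longrightarrow> (\<And>k. x k \<in> ball xs r \<Longrightarrow> x (Suc k) = \<Phi> (x k)) \<Longrightarrow>
      \<exists>C. \<forall>k. (norm (x k - xs))\<^sup>2 \<le> C * p ^ k"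
proof -
  define V where "V x = (a x)\<^sup>2 + \<sigma> * b x" for x
  have V0: "0 \<le> V x" for x using \<sigma> ab(3)[of x] by (simp add: V_def)
  \<comment> \<open>For \<open>V x\<close> at most 1, \<open>(a x)\<^sup>2\<close> is at most
    \<open>V x\<close> and \<open>(b x)\<^sup>2\<close> at most
    \<open>V x / \<sigma>\<^sup>2\<close>; \<open>c\<close> adds the two factors.\<close>
  define c where "c = 1 + 1 / \<sigma>\<^sup>2"
  have c: "0 < c" by (simp add: c_def add_pos_nonneg)
  \<comment> \<open>The cap 1 gives that the square of \<open>V x\<close> is at most
    \<open>V x\<close>; the factor 2 in the other bound makes the inclusion in the open ball
    strict.\<close>
  define v where "v = min 1 (r\<^sup>2 / (2 * c))"
  have v: "0 < v" "v \<le> 1" using r c by (auto simp: v_def)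
  have norm_le: "(norm (x - xs))\<^sup>2 \<le> c * V x" if "V x \<le> v" for x
  proof -
    have "\<sigma> * b x \<le> V x" by (simp add: V_def)
    then have "(\<sigma> * b x)\<^sup>2 \<le> (V x)\<^sup>2" using \<sigma> ab(3)[of x] by (intro power_mono) auto
    also have "\<dots> \<le> V x * 1"
      unfolding power2_eq_square using V0 that v by (intro mult_left_mono) auto
    finally have "(b x)\<^sup>2 \<le> V x / \<sigma>\<^sup>2" using \<sigma> by (simp add: power_mult_distrib field_simps)
    moreover have "(a x)\<^sup>2 \<le> V x" using \<sigma> ab(3)[of x] by (simp add: V_def)
    ultimately show ?thesis by (simp add: ab(1) c_def distrib_right)
  qed
  have ball: "x \<in> ball xs r" if "V x \<le> v" for x
  proof -
    have "(norm (x - xs))\<^sup>2 \<le> c * V x" using that by (rule norm_le)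
    also have "\<dots> \<le> c * (r\<^sup>2 / (2 * c))" using that c by (intro mult_left_mono) (auto simp: v_def)
    also have "\<dots> < r\<^sup>2" using c r by simp
    finally have "norm (x - xs) < r" by (rule power_less_imp_less_base) (use r in simp)
    then show ?thesis by (simp add: dist_norm norm_minus_commute)
  qed
  \<comment> \<open>Since \<open>\<epsilon>\<close> is at most 1, \<open>(a x)\<^sup>2\<close> is at
    most \<open>\<epsilon>\<close>, so \<open>V x\<close> is at most
    \<open>\<epsilon> * (1 + \<sigma>)\<close>.\<close>
  define \<epsilon> where "\<epsilon> = min 1 (v / (1 + \<sigma>))"
  have \<epsilon>: "0 < \<epsilon>" "\<epsilon> \<le> 1" using v \<sigma> by (auto simp: \<epsilon>_def)
  have V_le: "V x \<le> v" if "x \<in> ball xs \<epsilon>" for x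
  proof -
    have n: "norm (x - xs) \<le> \<epsilon>" using that by (simp add: dist_norm norm_minus_commute)
    have a: "(a x)\<^sup>2 \<le> \<epsilon>"
    proof -
      have "(a x)\<^sup>2 \<le> (norm (x - xs))\<^sup>2" by (simp add: ab(1))
      also have "\<dots> \<le> \<epsilon>\<^sup>2" using n by (intro power_mono) auto
      also have "\<dots> \<le> \<epsilon> * 1" unfolding power2_eq_square using \<epsilon> by (intro mult_left_mono) auto
      finally show ?thesis by simp
    qed
    have b: "b x \<le> \<epsilon>"
      by (rule order_trans[OF _ n], rule power2_le_imp_le) (simp_all add: ab(1))
    have "V x \<le> \<epsilon> * (1 + \<sigma>)"
      using add_mono[OF a mult_left_mono[OF b, of \<sigma>]] \<sigma> by (simp add: V_def algebra_simps)
    also have "\<dots> \<le> v / (1 + \<sigma>) * (1 + \<sigma>)" using \<sigma> by (intro mult_right_mono) (auto simp: \<epsilon>_def)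
    also have "\<dots> = v" using \<sigma> by simp
    finally show ?thesis .
  qed
  have step: "V (\<Phi> x) \<le> p\<^sup>2 * V x" if "V x \<le> v" for x
    using dec[OF ball[OF that]] by (simp add: V_def)
  \<comment> \<open>The induction keeps a single factor \<open>p\<close> per step, the rate claimed
    for the squared norm.\<close>
  have p2: "p\<^sup>2 \<le> p" using mult_left_mono[OF p(2) p(1)] by (simp add: power2_eq_square)
  have all: "V (x k) \<le> v \<and> V (x k) \<le> p ^ k * V (x 0)"
    if x0: "x 0 \<in> ball xs \<epsilon>" and x: "\<And>k. x k \<in> ball xs r \<Longrightarrow> x (Suc k) = \<Phi> (x k)" for x k
  proof (induction k)
    case 0
    show ?case using V_le[OF x0] by simp
  next
    case (Suc k)
    have "V (x (Suc k)) \<le> p\<^sup>2 * V (x k)" using x[OF ball] step Suc by simp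
    also have "\<dots> \<le> p * V (x k)" using p2 V0 by (rule mult_right_mono)
    finally have *: "V (x (Suc k)) \<le> p * V (x k)" .
    also have "\<dots> \<le> 1 * V (x k)" using p(2) V0 by (rule mult_right_mono)
    finally have "V (x (Suc k)) \<le> v" using Suc by simp
    moreover have "p * V (x k) \<le> p * (p ^ k * V (x 0))" using Suc p by (intro mult_left_mono) auto
    ultimately show ?case using * by (simp add: mult.assoc)
  qed
  show ?thesis
  proof (rule that[OF \<epsilon>(1)])
    show "x k \<in> ball xs r" if "x 0 \<in> ball xs \<epsilon>" "\<And>k. x k \<in> ball xs r \<Longrightarrow> x (Suc k) = \<Phi> (x k)" for x k
      using all[of x k, OF that] ball by blast
    show "\<exists>C. \<forall>k. (norm (x k - xs))\<^sup>2 \<le> C * p ^ k"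
      if "x 0 \<in> ball xs \<epsilon>" "\<And>k. x k \<in> ball xs r \<Longrightarrow> x (Suc k) = \<Phi> (x k)" for x
    proof (intro exI[of _ "c * V (x 0)"] allI)
      fix k
      have "(norm (x k - xs))\<^sup>2 \<le> c * V (x k)" using all[of x k, OF that] norm_le by blast
      also have "\<dots> \<le> c * (p ^ k * V (x 0))"
        using all[of x k, OF that] c by (intro mult_left_mono) auto
      finally show "(norm (x k - xs))\<^sup>2 \<le> c * V (x 0) * p ^ k" by (simp add: mult_ac)
    qed
  qed
qed

subsection \<open>The Riemannian Hessian and the local estimate\<close>

lemma tan_proj_mult: "tan_proj F x *v v = v - pinv (jacobian F (at x)) *v (jacobian F (at x) *v v)"
  by (simp add: tan_proj_def matrix_vector_mult_diff_rdistrib matrix_vector_mul_assoc)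

lemma nor_proj_mult: "nor_proj F x *v v = pinv (jacobian F (at x)) *v (jacobian F (at x) *v v)"
  by (simp add: nor_proj_def matrix_vector_mul_assoc)

lemma sum_scaleR_matrix_vector_mult:
  fixes M :: "'i \<Rightarrow> real^'n^'m"
  shows "(\<Sum>i\<in>I. c i *\<^sub>R M i) *v v = (\<Sum>i\<in>I. c i *\<^sub>R (M i *v v))"
  by (induction I rule: infinite_finite_induct)
    (simp_all add: matrix_vector_mult_add_rdistrib scaleR_matrix_vector_assoc)

definition lagrangian_hessian ::
    "(real^'n \<Rightarrow> real) \<Rightarrow> (real^'n \<Rightarrow> real^'m) \<Rightarrow> real^'m \<Rightarrow> real^'n \<Rightarrow> real^'n^'n"
  where "lagrangian_hessian f F w x = hessian f x - (\<Sum>i\<in>UNIV. w $ i *\<^sub>R hessian (\<lambda>y. F y $ i) x)"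

lemma lagrangian_hessian_mult:
  "lagrangian_hessian f F w x *v v =
    hessian f x *v v - (\<Sum>i\<in>UNIV. w $ i *\<^sub>R (hessian (\<lambda>y. F y $ i) x *v v))"
  by (simp add: lagrangian_hessian_def matrix_vector_mult_diff_rdistrib sum_scaleR_matrix_vector_mult)

text \<open>Linearity moves both projections out of the sum over the constraints, which leaves the
  Lagrangian Hessian at the multiplier \<open>w x\<close>.\<close>

lemma riem_hessian_mult:
  fixes f :: "real^'n \<Rightarrow> real" and F :: "real^'n \<Rightarrow> real^'m"
  defines "w \<equiv> \<lambda>x. transpose (pinv (jacobian F (at x))) *v gradient f x"
  shows "riem_hessian f F x *v v =
    tan_proj F x *v (lagrangian_hessian f F (w x) x *v (tan_proj F x *v v))"
proof -
  let ?P = "tan_proj F x"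
  have sum: "?P *v (\<Sum>i\<in>UNIV. c i *\<^sub>R u i) = (\<Sum>i\<in>UNIV. c i *\<^sub>R (?P *v u i))"
    for c :: "'m \<Rightarrow> real" and u
    by (simp add: linear_sum[OF matrix_vector_mul_linear] matrix_vector_mult_scaleR)
  show ?thesis
    unfolding riem_hessian_def lagrangian_hessian_mult w_def
    by (simp add: matrix_vector_mult_diff_rdistrib sum_scaleR_matrix_vector_mult
        matrix_vector_mult_diff_distrib sum flip: matrix_vector_mul_assoc)
qed

lemma lagrangian_hessian_symmetric:
  fixes f :: "real^'n \<Rightarrow> real" and F :: "real^'n \<Rightarrow> real^'m"
  assumes f: "\<And>y. f differentiable (at y)" and f': "fderiv f differentiable (at x)"
    and F: "\<And>y. F differentiable (at y)" and F': "fderiv F differentiable (at x)"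
  shows "u \<bullet> (lagrangian_hessian f F w x *v v) = v \<bullet> (lagrangian_hessian f F w x *v u)"
proof -
  have "(\<lambda>y. F y $ i) differentiable (at y)" for i y
    using has_derivative_component_jacobian[OF F] unfolding differentiable_def by blast
  then have "u \<bullet> (hessian (\<lambda>y. F y $ i) x *v v) = v \<bullet> (hessian (\<lambda>y. F y $ i) x *v u)" for i
    by (rule hessian_symmetric) (rule differentiable_gradient_component[OF F F'])
  then show ?thesis
    using hessian_symmetric[OF f differentiable_gradient[OF f f'], of u v]
    by (simp add: lagrangian_hessian_mult inner_diff_right inner_sum_right)
qed

text \<open>The rows of the Jacobian are the component gradients. With \<open>w\<close> fixed, the
  Lagrangian gradient is therefore a linear combination of gradients, each with its own Hessian as
  derivative.\<close>

lemma has_derivative_lagrangian_gradient: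
  fixes f :: "real^'n \<Rightarrow> real" and F :: "real^'n \<Rightarrow> real^'m"
  assumes f: "\<And>y. f differentiable (at y)" and f': "fderiv f differentiable (at x)"
    and F: "\<And>y. F differentiable (at y)" and F': "fderiv F differentiable (at x)"
  shows "((\<lambda>y. gradient f y - transpose (jacobian F (at y)) *v w) has_derivative
    (\<lambda>h. lagrangian_hessian f F w x *v h)) (at x)"
proof -
  have "(\<lambda>y. gradient f y - transpose (jacobian F (at y)) *v w) =
      (\<lambda>y. gradient f y - (\<Sum>i\<in>UNIV. w $ i *\<^sub>R gradient (\<lambda>y. F y $ i) y))"
    by (simp only: transpose_mult_eq_sum gradient_component[OF F])
  moreover have "((\<lambda>y. gradient f y - (\<Sum>i\<in>UNIV. w $ i *\<^sub>R gradient (\<lambda>y. F y $ i) y)) has_derivative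
      (\<lambda>h. hessian f x *v h - (\<Sum>i\<in>UNIV. w $ i *\<^sub>R (hessian (\<lambda>y. F y $ i) x *v h)))) (at x)"
    by (intro has_derivative_diff has_derivative_sum has_derivative_scaleR_right has_derivative_hessian
        differentiable_gradient[OF f f'] differentiable_gradient_component[OF F F'])
  ultimately show ?thesis by (simp add: lagrangian_hessian_mult)
qed

section \<open>Spectral bounds and the tangential contraction\<close>

text \<open>The ordering of the two extended reals excludes an empty set of unit tangents, so both
  are real numbers. Scaling to unit length then gives the bounds for all tangent vectors.\<close>

lemma riem_hessian_eigenvalue_bounds:
  fixes f :: "real^'n \<Rightarrow> real" and F :: "real^'n \<Rightarrow> real^'m"
  assumes pos: "0 < lambda_min f F x" and le: "lambda_min f F x \<le> lambda_max f F x"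
    and fin: "lambda_max f F x < \<infinity>"
  obtains l L where "lambda_min f F x = ereal l" "lambda_max f F x = ereal L" "0 < l" "l \<le> L"
    "\<And>u. jacobian F (at x) *v u = 0 \<Longrightarrow> l * (norm u)\<^sup>2 \<le> u \<bullet> (riem_hessian f F x *v u)"
    "\<And>u. jacobian F (at x) *v u = 0 \<Longrightarrow> u \<bullet> (riem_hessian f F x *v u) \<le> L * (norm u)\<^sup>2"
proof -
  obtain L where L: "lambda_max f F x = ereal L"
    using pos le fin by (cases "lambda_max f F x") auto
  obtain l where l: "lambda_min f F x = ereal l"
    using pos le fin by (cases "lambda_min f F x") auto
  let ?R = "riem_hessian f F x"
  have "l * (norm u)\<^sup>2 \<le> u \<bullet> (?R *v u) \<and> u \<bullet> (?R *v u) \<le> L * (norm u)\<^sup>2"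
    if u: "jacobian F (at x) *v u = 0" for u
  proof (cases "u = 0")
    case False
    define z where "z = (1 / norm u) *\<^sub>R u"
    have "z \<in> unit_tangent F x"
      using u False by (simp add: unit_tangent_def z_def matrix_vector_mult_scaleR)
    then have "ereal l \<le> ereal (z \<bullet> (?R *v z))" "ereal (z \<bullet> (?R *v z)) \<le> ereal L"
      unfolding l[symmetric] L[symmetric] lambda_min_def lambda_max_def
      by (auto intro: INF_lower SUP_upper)
    moreover have "u = norm u *\<^sub>R z" using False by (simp add: z_def)
    then have "u \<bullet> (?R *v u) = (norm u)\<^sup>2 * (z \<bullet> (?R *v z))"
      by (metis inner_scaleR_left inner_scaleR_right matrix_vector_mult_scaleR mult.assoc power2_eq_square)
    ultimately show ?thesis by (simp add: mult.commute[of _ "(norm u)\<^sup>2"] mult_left_mono)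
  qed simp
  with that[OF l L] pos le show ?thesis unfolding l L by auto
qed

text \<open>The stepsize \<open>1 / L\<close> makes the symmetric operator \<open>S\<close> positive
  semidefinite, so the upper bound \<open>1 - l / L\<close> on its form is also a bound on its
  norm.\<close>

lemma projected_gradient_contraction:
  fixes H :: "real^'n^'n" and P :: "real^'n \<Rightarrow> real^'n"
  assumes lin: "linear P" and idem: "\<And>v. P (P v) = P v" and symP: "\<And>u v. u \<bullet> P v = v \<bullet> P u"
    and symH: "\<And>u v. u \<bullet> (H *v v) = v \<bullet> (H *v u)"
    and lower: "\<And>u. l * (norm (P u))\<^sup>2 \<le> P u \<bullet> (H *v P u)"
    and upper: "\<And>u. P u \<bullet> (H *v P u) \<le> L * (norm (P u))\<^sup>2"
    and l: "0 < l" "l \<le> L" and contr: "\<And>v. norm (P v) \<le> norm v"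
  shows "norm (P (P e) - (1 / L) *\<^sub>R P (H *v P e)) \<le> (1 - l / L) * norm (P e)"
proof -
  define S where "S v = P v - (1 / L) *\<^sub>R P (H *v P v)" for v
  have L: "0 < L" using l by simp
  have form: "u \<bullet> S v = P u \<bullet> P v - (1 / L) * (P u \<bullet> (H *v P v))" for u v
  proof -
    have "u \<bullet> P v = P u \<bullet> P v" using symP[of u "P v"] by (simp add: idem inner_commute)
    moreover have "u \<bullet> P (H *v P v) = P u \<bullet> (H *v P v)" using symP[of u] by (simp add: inner_commute)
    ultimately show ?thesis by (simp add: S_def inner_diff_right)
  qed
  have "norm (S (P e)) \<le> (1 - l / L) * norm (P e)"
  proof (rule symmetric_PSD_norm_le)
    show "linear S"
      unfolding S_def by (rule linearI) (simp_all add: linear_add[OF lin] linear_cmul[OF lin]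
        matrix_vector_right_distrib matrix_vector_mult_scaleR algebra_simps)
    show "u \<bullet> S v = v \<bullet> S u" for u v
      using symH[of "P u" "P v"] by (simp add: form inner_commute)
    show "0 \<le> u \<bullet> S u" for u
      using upper[of u] L by (simp add: form field_simps flip: power2_norm_eq_inner)
    show "u \<bullet> S u \<le> (1 - l / L) * (norm u)\<^sup>2" for u
    proof -
      have "u \<bullet> S u \<le> (1 - l / L) * (norm (P u))\<^sup>2"
        using lower[of u] L by (simp add: form field_simps flip: power2_norm_eq_inner)
      \<comment> \<open>The norm lemma needs a form bound on the whole space, not just on the range
        of \<open>P\<close>.\<close>
      also have "\<dots> \<le> (1 - l / L) * (norm u)\<^sup>2"
        using contr l L by (intro mult_left_mono power_mono) auto
      finally show ?thesis .
    qed
    show "0 \<le> 1 - l / L" using l L by simp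
  qed
  then show ?thesis by (simp add: S_def idem)
qed

text \<open>A total function of \<open>x\<close>, identified with the minimizing step by
  \<open>sqp_step_iff\<close> where the Jacobian has full row rank.\<close>

definition sqp_map ::
    "(real^'n \<Rightarrow> real) \<Rightarrow> (real^'n \<Rightarrow> real^'m) \<Rightarrow> real \<Rightarrow> real^'n \<Rightarrow> real^'n"
  where "sqp_map f F \<eta> x =
    x - \<eta> *\<^sub>R (tan_proj F x *v gradient f x) - pinv (jacobian F (at x)) *v F x"

text \<open>The constant \<open>C\<close> is fixed before \<open>\<tau>\<close>, and only the radius
  depends on \<open>\<tau>\<close>. The term with \<open>\<tau>\<close> absorbs the remainder from
  differentiability of the Lagrangian gradient at \<open>xs\<close>, together with the quadratic
  tangential errors.\<close>

lemma sqp_map_local_estimate: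
  fixes f :: "real^'n \<Rightarrow> real" and F :: "real^'n \<Rightarrow> real^'m"
  assumes f: "\<And>y. f differentiable (at y)" and f': "fderiv f differentiable (at xs)"
    and F: "\<And>y. F differentiable (at y)" and F': "fderiv F differentiable (at xs)"
    and lip: "\<beta>-lipschitz_on (ball xs \<delta>) (fderiv F)" and \<delta>: "0 < \<delta>"
    and inv: "\<And>x. x \<in> ball xs \<delta> \<Longrightarrow> invertible (jacobian F (at x) ** transpose (jacobian F (at x)))"
    and Fxs: "F xs = 0"
    and crit: "gradient f xs = nor_proj F xs *v gradient f xs"
    and bounds: "\<And>u. jacobian F (at xs) *v u = 0 \<Longrightarrow> l * (norm u)\<^sup>2 \<le> u \<bullet> (riem_hessian f F xs *v u)"
      "\<And>u. jacobian F (at xs) *v u = 0 \<Longrightarrow> u \<bullet> (riem_hessian f F xs *v u) \<le> L * (norm u)\<^sup>2"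
    and l: "0 < l" "l \<le> L"
  defines "a \<equiv> \<lambda>x. norm (tan_proj F xs *v (x - xs))"
    and "b \<equiv> \<lambda>x. norm (nor_proj F xs *v (x - xs))"
    and "\<Phi> \<equiv> sqp_map f F (1 / L)"
  obtains C where "0 \<le> C" "\<And>\<tau>. 0 < \<tau> \<Longrightarrow> \<exists>r>0. \<forall>x\<in>ball xs r. b (\<Phi> x) \<le> C * (norm (x - xs))\<^sup>2 \<and>
      a (\<Phi> x) \<le> (1 - l / L) * a x + C * b x + \<tau> * norm (x - xs)"
proof -
  define J where "J x = jacobian F (at x)" for x
  define B where "B = J xs"
  define w where "w = transpose (pinv B) *v gradient f xs"
  define H where "H = lagrangian_hessian f F w xs"
  define P where "P v = v - pinv B *v (B *v v)" for v
  define \<eta> where "\<eta> = 1 / L"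
  have L: "0 < L" and \<eta>: "0 < \<eta>" using l by (auto simp: \<eta>_def)
  have invB: "invertible (B ** transpose B)" using inv[of xs] \<delta> by (simp add: B_def J_def)
  have P: "tan_proj F xs *v v = P v" and N: "nor_proj F xs *v v = pinv B *v (B *v v)" for v
    by (simp_all add: tan_proj_mult nor_proj_mult P_def B_def J_def)
  have BP: "B *v P v = 0" for v by (simp add: P_def matrix_vector_mult_diff_distrib mult_pinv[OF invB])
  have PP: "P (P v) = P v" for v by (subst P_def) (simp add: BP)
  have symP: "u \<bullet> P v = v \<bullet> P u" for u v
    using pinv_mult_symmetric[OF invB, of u v] by (simp add: P_def inner_diff_right inner_commute)
  have linP: "linear P"
    unfolding P_def by (rule linearI)
      (simp_all add: matrix_vector_right_distrib matrix_vector_mult_scaleR algebra_simps)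
  have quad: "P u \<bullet> (riem_hessian f F xs *v P u) = P u \<bullet> (H *v P u)" for u
  proof -
    have "riem_hessian f F xs *v P u = P (H *v P (P u))"
      unfolding riem_hessian_mult P H_def w_def B_def J_def ..
    then show ?thesis using symP[of "P u" "H *v P u"] by (simp add: PP inner_commute)
  qed
  have contr: "norm (P (P e) - \<eta> *\<^sub>R P (H *v P e)) \<le> (1 - l / L) * norm (P e)" for e
    unfolding \<eta>_def
  proof (rule projected_gradient_contraction[OF linP PP symP _ _ _ l])
    show "u \<bullet> (H *v v) = v \<bullet> (H *v u)" for u v
      unfolding H_def by (rule lagrangian_hessian_symmetric[OF f f' F F'])
    show "l * (norm (P u))\<^sup>2 \<le> P u \<bullet> (H *v P u)" "P u \<bullet> (H *v P u) \<le> L * (norm (P u))\<^sup>2" for u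
      using bounds[of "P u"] BP[of u] unfolding quad B_def J_def by blast+
    show "norm (P v) \<le> norm v" for v unfolding P_def by (rule norm_kernel_part_le[OF invB])
  qed
  define K where "K = onorm (\<lambda>v. pinv B *v v)"
  have K: "norm (pinv B *v v) \<le> K * norm v" "0 \<le> K" for v
    unfolding K_def by (auto intro: onorm onorm_pos_le)
  define h where "h = onorm (\<lambda>v. H *v v)"
  have h: "norm (H *v v) \<le> h * norm v" "0 \<le> h" for v
    unfolding h_def by (auto intro: onorm onorm_pos_le)
  have \<beta>: "0 \<le> \<beta>" using lip by (rule lipschitz_on_nonneg)
  define M where "M = 2 * K * \<beta> * (2 + \<eta> * (h + 1))"
  have M: "0 \<le> M" using K(2) h(2) \<beta> \<eta> by (simp add: M_def)
  define G where "G y = gradient f y - transpose (J y) *v w" for y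
  have "transpose B *v w = transpose (pinv B ** B) *v gradient f xs"
    by (simp only: w_def matrix_transpose_mul matrix_vector_mul_assoc)
  also have "\<dots> = gradient f xs"
    unfolding transpose_pinv_mult[OF invB] using crit[symmetric] by (simp only: nor_proj_def B_def J_def)
  finally have G0: "G xs = 0" by (simp only: G_def B_def diff_self)
  have derG: "(G has_derivative (\<lambda>v. H *v v)) (at xs)"
    unfolding G_def J_def H_def by (rule has_derivative_lagrangian_gradient[OF f f' F F'])
  show ?thesis
  \<comment> \<open>One constant serves both estimates: \<open>M\<close> for the quadratic normal
    error and \<open>\<eta> * h\<close> for the influence of the normal error on the tangential
    one.\<close>
  proof (rule that[of "M + \<eta> * h"])
    show "0 \<le> M + \<eta> * h" using M \<eta> h(2) by simp
    fix \<tau> :: real assume \<tau>: "0 < \<tau>"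
    \<comment> \<open>The cap 1 meets the hypothesis on the remainder in
      \<open>sqp_map_estimate\<close>; the other bound reserves half of \<open>\<tau>\<close> for
      that remainder.\<close>
    define t where "t = min 1 (\<tau> / (2 * \<eta>))"
    have t: "0 < t" "t \<le> 1" "\<eta> * t \<le> \<tau> / 2"
      using \<tau> \<eta> by (auto simp: t_def min_def field_simps)
    obtain r0 where r0: "0 < r0" and
      rG: "\<And>x. norm (x - xs) < r0 \<Longrightarrow> norm (G x - G xs - H *v (x - xs)) \<le> t * norm (x - xs)"
      using derG t(1) unfolding has_derivative_at_alt by blast
    \<comment> \<open>In order, the bounds secure full rank and the Lipschitz estimate, the
      expansion of \<open>G\<close>, the smallness condition for the pseudoinverse, and the other
      half of \<open>\<tau>\<close> for the quadratic error.\<close>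
    define r where "r = Min {\<delta>, r0, 1 / (2 * (\<beta> * K + 1)), \<tau> / (2 * (M + 1))}"
    have \<beta>K: "0 < 2 * (\<beta> * K + 1)" and M1: "0 < 2 * (M + 1)" using \<beta> K(2) M by (auto intro: add_nonneg_pos)
    have r: "0 < r" "r \<le> \<delta>" "r \<le> r0" "r \<le> 1 / (2 * (\<beta> * K + 1))" "r \<le> \<tau> / (2 * (M + 1))"
      using \<delta> r0 \<beta>K M1 \<tau> by (auto simp: r_def)
    have "b (\<Phi> x) \<le> (M + \<eta> * h) * (norm (x - xs))\<^sup>2 \<and>
        a (\<Phi> x) \<le> (1 - l / L) * a x + (M + \<eta> * h) * b x + \<tau> * norm (x - xs)"
      if x: "x \<in> ball xs r" for x
    proof -
      define e where "e = x - xs"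
      have er: "norm e < r" using x by (simp add: e_def dist_norm norm_minus_commute)
      have xd: "x \<in> ball xs \<delta>" and xsd: "xs \<in> ball xs \<delta>" using x r(2) \<delta> by auto
      have invA: "invertible (J x ** transpose (J x))" using inv[OF xd] by (simp add: J_def)
      have d: "norm ((J x - B) *v v) \<le> \<beta> * norm e * norm v" for v
        unfolding J_def B_def e_def by (rule jacobian_lipschitz[OF F lip xd xsd])
      have small: "\<beta> * norm e * K \<le> 1 / 2"
      proof -
        have "norm e * (2 * (\<beta> * K + 1)) \<le> 1" 
          using order_trans[OF less_imp_le[OF er] r(4)] by (simp only: pos_le_divide_eq[OF \<beta>K])
        then show ?thesis by (simp add: algebra_simps) (use norm_ge_zero[of e] in linarith)
      qed
      have c: "norm (F x - J x *v e) \<le> \<beta> * (norm e)\<^sup>2"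
        using linearization_error[OF F lip convex_ball xd xsd] by (simp add: Fxs J_def e_def)
      have g: "norm (gradient f x - transpose (J x) *v w - H *v e) \<le> t * norm e"
        using rG[of x] er r(3) by (simp add: G0 e_def) (simp add: G_def)
      have s: "\<Phi> x - xs = e - \<eta> *\<^sub>R (gradient f x - pinv (J x) *v (J x *v gradient f x)) - pinv (J x) *v F x"
        by (simp add: \<Phi>_def sqp_map_def tan_proj_mult J_def e_def \<eta>_def)
      note est = sqp_map_estimate[OF invA invB K d \<beta> small c h(1) less_imp_le[OF \<eta>] g t(2) P_def contr,
          folded s M_def]
      have n0: "0 \<le> norm (pinv B *v (B *v e))" by simp
      have Me: "M * (norm e)\<^sup>2 \<le> \<tau> / 2 * norm e"
      proof -
        have "norm e * (2 * (M + 1)) \<le> \<tau>" 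
          using order_trans[OF less_imp_le[OF er] r(5)] by (simp only: pos_le_divide_eq[OF M1])
        then have "M * norm e \<le> \<tau> / 2" by (simp add: algebra_simps) (use norm_ge_zero[of e] in linarith)
        then have "M * norm e * norm e \<le> \<tau> / 2 * norm e" by (rule mult_right_mono) simp
        then show ?thesis by (simp only: power2_eq_square mult.assoc)
      qed
      have te: "\<eta> * t * norm e \<le> \<tau> / 2 * norm e" using t(3) by (rule mult_right_mono) simp
      have "b (\<Phi> x) \<le> M * (norm e)\<^sup>2" unfolding b_def N by (rule est)
      also have "\<dots> \<le> (M + \<eta> * h) * (norm e)\<^sup>2" using \<eta> h(2) by (intro mult_right_mono) auto
      finally have 1: "b (\<Phi> x) \<le> (M + \<eta> * h) * (norm e)\<^sup>2" .
      have "a (\<Phi> x) \<le> (1 - l / L) * norm (P e) + \<eta> * h * norm (pinv B *v (B *v e)) + \<tau> * norm e"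
        unfolding a_def P using est(2) Me te by linarith
      also have "\<dots> \<le> (1 - l / L) * norm (P e) + (M + \<eta> * h) * norm (pinv B *v (B *v e)) + \<tau> * norm e"
        using M by (intro add_mono mult_right_mono order_refl) auto
      finally have 2: "a (\<Phi> x) \<le> (1 - l / L) * a x + (M + \<eta> * h) * b x + \<tau> * norm e"
        by (simp add: a_def b_def P N e_def)
      show ?thesis using 1 2 by (simp add: e_def)
    qed
    with r(1) show "\<exists>r>0. \<forall>x\<in>ball xs r. b (\<Phi> x) \<le> (M + \<eta> * h) * (norm (x - xs))\<^sup>2 \<and>
        a (\<Phi> x) \<le> (1 - l / L) * a x + (M + \<eta> * h) * b x + \<tau> * norm (x - xs)" by blast
  qed
qed

section \<open>Local linear convergence of the SQP iterates\<close>

theorem theorem1: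
  fixes f :: "real^'n \<Rightarrow> real" and F :: "real^'n \<Rightarrow> real^'m" and xs :: "real^'n"
    and \<delta> L_f L_F \<beta>_f \<beta>_F \<rho>_f \<rho>_F \<gamma>_F :: real
  assumes "CARD('m) \<le> CARD('n)"
    and "C2_on UNIV f" and "C2_on UNIV F"
    and "local_minimizer_on f {x. F x = 0} xs"
    and "0 < \<delta>"
    and "L_f-lipschitz_on (ball xs \<delta>) f" and "L_F-lipschitz_on (ball xs \<delta>) F"
    and "\<beta>_f-lipschitz_on (ball xs \<delta>) (fderiv f)" and "\<beta>_F-lipschitz_on (ball xs \<delta>) (fderiv F)"
    and "\<rho>_f-lipschitz_on (ball xs \<delta>) (fderiv (fderiv f))"
    and "\<rho>_F-lipschitz_on (ball xs \<delta>) (fderiv (fderiv F))"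
    and "C2_submanifold (CARD('n) - CARD('m)) {x. F x = 0}"
    and "0 < \<gamma>_F" and "\<forall>x\<in>ball xs \<delta>. \<gamma>_F \<le> sigma_min (jacobian F (at x))"
    and "0 < lambda_min f F xs" and "lambda_min f F xs \<le> lambda_max f F xs"
    and "lambda_max f F xs < \<infinity>"
  shows "\<exists>\<epsilon>>0. \<exists>\<sigma>>0. \<forall>x0\<in>ball xs \<epsilon>.
    let \<eta> = 1 / real_of_ereal (lambda_max f F xs); \<kappa> = kappa_R f F xs in
    (\<exists>x. sqp_iterates f F \<eta> x \<and> x 0 = x0) \<and>
    (\<forall>x. sqp_iterates f F \<eta> x \<and> x 0 = x0 \<longrightarrow>
      (let a = (\<lambda>k. norm (tan_proj F xs *v (x k - xs)));
           b = (\<lambda>k. norm (nor_proj F xs *v (x k - xs)))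
       in (\<forall>k. (a (Suc k))\<^sup>2 + \<sigma> * b (Suc k) \<le> (1 - 1 / (2 * \<kappa>))\<^sup>2 * ((a k)\<^sup>2 + \<sigma> * b k)) \<and>
          (\<forall>k. (norm (x k - xs))\<^sup>2 = (a k)\<^sup>2 + (b k)\<^sup>2) \<and>
          (\<exists>C. \<forall>k. (norm (x k - xs))\<^sup>2 \<le> C * (1 - 1 / (2 * \<kappa>)) ^ k)))"
proof -
  have f: "\<And>y. f differentiable (at y)" "fderiv f differentiable (at xs)"
    and F: "\<And>y. F differentiable (at y)" "fderiv F differentiable (at xs)"
    using assms(2,3) by (auto simp: C2_on_def)
  have inv: "invertible (jacobian F (at x) ** transpose (jacobian F (at x)))" if "x \<in> ball xs \<delta>" for x
    using assms(13,14) that by (intro invertible_gram_if_sigma_min_pos) (meson less_le_trans)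
  have xs: "xs \<in> ball xs \<delta>" using \<open>0 < \<delta>\<close> by simp
  have Fxs: "F xs = 0" using assms(4) by (simp add: local_minimizer_on_def)
  have crit: "gradient f xs = nor_proj F xs *v gradient f xs"
    unfolding nor_proj_mult by (rule local_minimizer_gradient[OF f(1) F(1) inv[OF xs] assms(4)])
  obtain l L where lL: "lambda_min f F xs = ereal l" "lambda_max f F xs = ereal L" "0 < l" "l \<le> L"
    and bounds: "\<And>u. jacobian F (at xs) *v u = 0 \<Longrightarrow> l * (norm u)\<^sup>2 \<le> u \<bullet> (riem_hessian f F xs *v u)"
      "\<And>u. jacobian F (at xs) *v u = 0 \<Longrightarrow> u \<bullet> (riem_hessian f F xs *v u) \<le> L * (norm u)\<^sup>2"
    using riem_hessian_eigenvalue_bounds[OF assms(15-17)] by blast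
  define \<Phi> where "\<Phi> = sqp_map f F (1 / L)"
  define a where "a x = norm (tan_proj F xs *v (x - xs))" for x
  define b where "b x = norm (nor_proj F xs *v (x - xs))" for x
  \<comment> \<open>With condition number \<open>L / l\<close> this is the claimed factor; it
    exceeds the tangential factor \<open>1 - l / L\<close> by \<open>l / (2 * L)\<close>.\<close>
  define p where "p = 1 - l / (2 * L)"
  have L: "0 < L" using lL by simp
  have q: "0 \<le> 1 - l / L" "1 - l / L < p" and p: "0 \<le> p" "p \<le> 1"
    using lL(3,4) L by (auto simp: p_def field_simps)
  have ab: "(norm (x - xs))\<^sup>2 = (a x)\<^sup>2 + (b x)\<^sup>2" "0 \<le> a x" "0 \<le> b x" for x
    using norm_split_pinv[OF inv[OF xs], of "x - xs"]
    by (simp_all add: a_def b_def tan_proj_mult nor_proj_mult)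
  obtain C where C: "0 \<le> C" "\<And>\<tau>. 0 < \<tau> \<Longrightarrow> \<exists>r>0. \<forall>x\<in>ball xs r. b (\<Phi> x) \<le> C * (norm (x - xs))\<^sup>2 \<and>
      a (\<Phi> x) \<le> (1 - l / L) * a x + C * b x + \<tau> * norm (x - xs)"
    using sqp_map_local_estimate[OF f F assms(9,5) inv Fxs crit bounds lL(3,4)]
    unfolding a_def b_def \<Phi>_def by blast
  obtain \<sigma> r where \<sigma>: "0 < \<sigma>" and r: "0 < r" "r \<le> \<delta>" and
    dec: "\<And>x. x \<in> ball xs r \<Longrightarrow> (a (\<Phi> x))\<^sup>2 + \<sigma> * b (\<Phi> x) \<le> p\<^sup>2 * ((a x)\<^sup>2 + \<sigma> * b x)"
    using lyapunov_decrease[OF ab q C \<open>0 < \<delta>\<close>] by blast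
  obtain \<epsilon> where \<epsilon>: "0 < \<epsilon>" and
    stay: "\<And>x k. x 0 \<in> ball xs \<epsilon> \<Longrightarrow> (\<And>k. x k \<in> ball xs r \<Longrightarrow> x (Suc k) = \<Phi> (x k)) \<Longrightarrow> x k \<in> ball xs r" and
    rate: "\<And>x. x 0 \<in> ball xs \<epsilon> \<Longrightarrow> (\<And>k. x k \<in> ball xs r \<Longrightarrow> x (Suc k) = \<Phi> (x k)) \<Longrightarrow>
      \<exists>C. \<forall>k. (norm (x k - xs))\<^sup>2 \<le> C * p ^ k"
    using lyapunov_iteration[OF ab p \<sigma> r(1) dec] by blast
  \<comment> \<open>The equivalence is used both ways: orbits of \<open>\<Phi>\<close> in the ball
    are SQP sequences, and every SQP sequence follows \<open>\<Phi>\<close> while it is in the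
    ball.\<close>
  have step: "is_arg_min (\<lambda>y. f x + gradient f x \<bullet> (y - x) + 1 / (2 * (1 / L)) * (norm (y - x))\<^sup>2)
      (\<lambda>y. F x + jacobian F (at x) *v (y - x) = 0) y \<longleftrightarrow> y = \<Phi> x" if "x \<in> ball xs r" for x y
  proof -
    have "x \<in> ball xs \<delta>" using that r(2) by auto
    from sqp_step_iff[OF inv[OF this], of "1 / L" "f x" "gradient f x" x "F x" y] L
    show ?thesis by (simp add: \<Phi>_def sqp_map_def tan_proj_mult)
  qed
  have \<eta>: "real_of_ereal (lambda_max f F xs) = L" and \<kappa>: "1 - 1 / (2 * kappa_R f F xs) = p"
    by (simp_all add: lL kappa_R_def p_def)
  have "(\<exists>x. sqp_iterates f F (1 / L) x \<and> x 0 = x0) \<and>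
    (\<forall>x. sqp_iterates f F (1 / L) x \<and> x 0 = x0 \<longrightarrow>
      (\<forall>k. (a (x (Suc k)))\<^sup>2 + \<sigma> * b (x (Suc k)) \<le> p\<^sup>2 * ((a (x k))\<^sup>2 + \<sigma> * b (x k))) \<and>
      (\<forall>k. (norm (x k - xs))\<^sup>2 = (a (x k))\<^sup>2 + (b (x k))\<^sup>2) \<and>
      (\<exists>C. \<forall>k. (norm (x k - xs))\<^sup>2 \<le> C * p ^ k))" if x0: "x0 \<in> ball xs \<epsilon>" for x0
  proof (intro conjI allI impI)
    \<comment> \<open>The orbit of \<open>\<Phi>\<close> never leaves the ball of radius
      \<open>r\<close>, so each of its steps solves the subproblem and SQP iterates exist from every
      \<open>x0\<close>.\<close>
    define x where "x k = (\<Phi> ^^ k) x0" for k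
    have "x k \<in> ball xs r" for k by (rule stay) (use x0 in \<open>simp_all add: x_def\<close>)
    then have "sqp_iterates f F (1 / L) x" unfolding sqp_iterates_def using step by (simp add: x_def)
    then show "\<exists>x. sqp_iterates f F (1 / L) x \<and> x 0 = x0" by (intro exI[of _ x]) (simp add: x_def)
  next
    fix x assume x: "sqp_iterates f F (1 / L) x \<and> x 0 = x0"
    then have x': "x 0 \<in> ball xs \<epsilon>" and next_iterate: "\<And>k. x k \<in> ball xs r \<Longrightarrow> x (Suc k) = \<Phi> (x k)"
      using x0 step unfolding sqp_iterates_def by blast+
    have ball: "x k \<in> ball xs r" for k by (rule stay[OF x' next_iterate])
    show "(a (x (Suc k)))\<^sup>2 + \<sigma> * b (x (Suc k)) \<le> p\<^sup>2 * ((a (x k))\<^sup>2 + \<sigma> * b (x k))" for k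
      using dec[OF ball] by (simp add: next_iterate[OF ball])
    show "(norm (x k - xs))\<^sup>2 = (a (x k))\<^sup>2 + (b (x k))\<^sup>2" for k by (rule ab)
    show "\<exists>C. \<forall>k. (norm (x k - xs))\<^sup>2 \<le> C * p ^ k" by (rule rate[OF x' next_iterate])
  qed
  with \<epsilon> \<sigma> show ?thesis unfolding Let_def \<eta> \<kappa> a_def b_def by blast
qed

end
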